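(* Let $(V,C,u)$ be an order unit space that is complete with respect to the order unit norm $\|\cdot\|_u$, whose cone $C$ is strictly convex, and with $\dim V\geq 3$. Then there exists a bijective antihomogeneous order-antimorphism $g\colon C^\circ\to C^\circ$ if and only if $(V,C,u)$ is a spin factor.
   Context: A cone $C$ in a real vector space $V$ (possibly infinite dimensional) is a convex set with $\lambda C\subseteq C$ for all $\lambda\geq 0$ and $C\cap -C=\{0\}$; it induces the partial order $x\leq_C y$ iff $y-x\in C$. $C$ is Archimedean if for all $x\in V$, $y\in C$ with $nx\leq_C y$ for all $n=1,2,\ldots$ one has $x\leq_C 0$. An element $u\in C$ is an order unit if for each $x\in V$ there is $\lambda\geq 0$ with $x\leq_C\lambda u$. $(V,C,u)$ is an order unit space if $C$ is an Archimedean cone with order unit $u$. The order unit norm is $\|x\|_u=\inf\{\lambda>0: -\lambda u\leq_C x\leq_C\lambda u\}$. The interior $C^\circ$ and boundary $\partial C$ are taken in the $\|\cdot\|_u$-topology; $C$ is closed and $C^\circ\neq\emptyset$. $C$ is strictly convex if for each linearly independent $x,y\in\partial C$ the segment $\{(1-\lambda)x+\lambda y: 0<\lambda<1\}$ is contained in $C^\circ$. A map $g\colon C^\circ\to C^\circ$ is an order-antimorphism if for all $x,y\in C^\circ$: $x\leq_C y$ if and only if $g(y)\leq_C g(x)$. It is antihomogeneous if $g(\lambda x)=\frac1\lambda g(x)$ for all $\lambda>0$, $x\in C^\circ$. A spin factor is a real vector space $M$ with $\dim M\geq 3$ such that $M=H\oplus\mathbb{R}e$ (vector space direct sum), with $(H,(\cdot\mid\cdot))$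 a real Hilbert space and $\mathbb{R}e$ the span of $e$, equipped with the Jordan product $(a+\alpha e)\circ(b+\beta e)=\beta a+\alpha b+((a\mid b)+\alpha\beta)e$ for $a,b\in H$, $\alpha,\beta\in\mathbb{R}$, and the norm $\|a+\lambda e\|=\|a\|_2+|\lambda|$, where $\|\cdot\|_2$ is the norm of $H$. It is regarded as an order unit space with cone the set of squares $\{a\circ a: a\in M\}$ and order unit $e$; the order unit norm is then the norm of $M$. "$(V,C,u)$ is a spin factor" means that there are a linear subspace $H\subseteq V$ and an inner product $(\cdot\mid\cdot)$ on $H$ making it a Hilbert space such that $V=H\oplus\mathbb{R}u$, and, with $e=u$ and the product above, $C=\{a\circ a: a\in V\}$ and $\|a+\lambda u\|_u=\|a\|_2+|\lambda|$ for all $a\in H$, $\lambda\in\mathbb{R}$. *)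

theory Defs
  imports "HOL-Analysis.Analysis"
begin

text \<open>
  The ambient space \<open>V\<close> is a type of class \<^class>\<open>real_vector\<close>, which carries no topology;
  all topological notions refer to the metric of the order unit norm.
\<close>

section \<open>Order unit spaces\<close>

definition pointed_cone :: "'a::real_vector set \<Rightarrow> bool" where
  "pointed_cone C \<longleftrightarrow> convex C \<and> cone C \<and> C \<inter> uminus ` C = {0}"

definition cone_le :: "'a::real_vector set \<Rightarrow> 'a \<Rightarrow> 'a \<Rightarrow> bool" where
  "cone_le C x y \<longleftrightarrow> y - x \<in> C"

definition archimedean_cone :: "'a::real_vector set \<Rightarrow> bool" where
  "archimedean_cone C \<longleftrightarrow>
     pointed_cone C \<and>
     (\<forall>x. \<forall>y\<in>C. (\<forall>n::nat. 1 \<le> n \<longrightarrow> cone_le C (real n *\<^sub>R x) y) \<longrightarrow> cone_le C x 0)"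

definition order_unit :: "'a::real_vector set \<Rightarrow> 'a \<Rightarrow> bool" where
  "order_unit C u \<longleftrightarrow> u \<in> C \<and> (\<forall>x. \<exists>\<mu>::real. 0 \<le> \<mu> \<and> cone_le C x (\<mu> *\<^sub>R u))"

definition order_unit_space :: "'a::real_vector set \<Rightarrow> 'a \<Rightarrow> bool" where
  "order_unit_space C u \<longleftrightarrow> archimedean_cone C \<and> order_unit C u"

definition ou_norm :: "'a::real_vector set \<Rightarrow> 'a \<Rightarrow> 'a \<Rightarrow> real" where
  "ou_norm C u x =
     Inf {\<mu>. 0 < \<mu> \<and> cone_le C (- (\<mu> *\<^sub>R u)) x \<and> cone_le C x (\<mu> *\<^sub>R u)}"

definition ou_dist :: "'a::real_vector set \<Rightarrow> 'a \<Rightarrow> 'a \<Rightarrow> 'a \<Rightarrow> real" where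
  "ou_dist C u x y = ou_norm C u (x - y)"

definition ou_topology :: "'a::real_vector set \<Rightarrow> 'a \<Rightarrow> 'a topology" where
  "ou_topology C u = Metric_space.mtopology UNIV (ou_dist C u)"

definition ou_complete :: "'a::real_vector set \<Rightarrow> 'a \<Rightarrow> bool" where
  "ou_complete C u \<longleftrightarrow> Metric_space.mcomplete UNIV (ou_dist C u)"

definition cone_interior :: "'a::real_vector set \<Rightarrow> 'a \<Rightarrow> 'a set" where
  "cone_interior C u = ou_topology C u interior_of C"

definition cone_boundary :: "'a::real_vector set \<Rightarrow> 'a \<Rightarrow> 'a set" where
  "cone_boundary C u = ou_topology C u frontier_of C"

text \<open>
  Linear independence of the family \<open>x, y\<close> is independence of the set \<open>{x, y}\<close> together
  with \<open>x \<noteq> y\<close>.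
\<close>

definition strictly_convex_cone :: "'a::real_vector set \<Rightarrow> 'a \<Rightarrow> bool" where
  "strictly_convex_cone C u \<longleftrightarrow>
     (\<forall>x\<in>cone_boundary C u. \<forall>y\<in>cone_boundary C u.
        x \<noteq> y \<and> independent {x, y} \<longrightarrow>
        {(1 - \<mu>) *\<^sub>R x + \<mu> *\<^sub>R y | \<mu>::real. 0 < \<mu> \<and> \<mu> < 1} \<subseteq> cone_interior C u)"

text \<open>
  The library function \<open>dim\<close> is \<open>0\<close> on infinite-dimensional spaces, so the dimension bound
  is expressed through a basis.
\<close>

definition dim_at_least :: "'a::real_vector itself \<Rightarrow> nat \<Rightarrow> bool" where
  "dim_at_least _ n \<longleftrightarrow>
     (\<exists>B::'a set. independent B \<and> span B = UNIV \<and> (infinite B \<or> n \<le> card B))"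

section \<open>Maps on the open cone\<close>

definition order_antimorphism_on :: "'a::real_vector set \<Rightarrow> 'a set \<Rightarrow> ('a \<Rightarrow> 'a) \<Rightarrow> bool" where
  "order_antimorphism_on C S g \<longleftrightarrow>
     g ` S \<subseteq> S \<and> (\<forall>x\<in>S. \<forall>y\<in>S. cone_le C x y \<longleftrightarrow> cone_le C (g y) (g x))"

definition antihomogeneous_on :: "'a::real_vector set \<Rightarrow> ('a \<Rightarrow> 'a) \<Rightarrow> bool" where
  "antihomogeneous_on S g \<longleftrightarrow>
     (\<forall>\<mu>::real. \<forall>x\<in>S. 0 < \<mu> \<longrightarrow> g (\<mu> *\<^sub>R x) = (1 / \<mu>) *\<^sub>R g x)"

section \<open>Spin factors\<close>

definition inner_product_on :: "'a::real_vector set \<Rightarrow> ('a \<Rightarrow> 'a \<Rightarrow> real) \<Rightarrow> bool" where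
  "inner_product_on H ip \<longleftrightarrow>
     (\<forall>x\<in>H. \<forall>y\<in>H. ip x y = ip y x) \<and>
     (\<forall>x\<in>H. \<forall>y\<in>H. \<forall>z\<in>H. ip (x + y) z = ip x z + ip y z) \<and>
     (\<forall>r::real. \<forall>x\<in>H. \<forall>y\<in>H. ip (r *\<^sub>R x) y = r * ip x y) \<and>
     (\<forall>x\<in>H. 0 \<le> ip x x) \<and>
     (\<forall>x\<in>H. ip x x = 0 \<longleftrightarrow> x = 0)"

text \<open>Values of \<open>ip\<close> outside \<open>H\<close> are irrelevant: \<open>mcomplete\<close> only inspects distances in \<open>H\<close>.\<close>

definition hilbert_subspace :: "'a::real_vector set \<Rightarrow> ('a \<Rightarrow> 'a \<Rightarrow> real) \<Rightarrow> bool" where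
  "hilbert_subspace H ip \<longleftrightarrow>
     subspace H \<and> inner_product_on H ip \<and>
     Metric_space.mcomplete H (\<lambda>x y. sqrt (ip (x - y) (x - y)))"

definition direct_sum_decomposition :: "'a::real_vector set \<Rightarrow> 'a set \<Rightarrow> bool" where
  "direct_sum_decomposition H K \<longleftrightarrow>
     subspace H \<and> subspace K \<and> H \<inter> K = {0} \<and> {h + k | h k. h \<in> H \<and> k \<in> K} = UNIV"

text \<open>
  The description below determines a unique element when the whole space is the direct sum of
  \<open>H\<close> and \<open>span {e}\<close> and \<open>e \<noteq> 0\<close>; see \<open>spin_product_eq\<close>.
\<close>

definition spin_product ::
    "'a::real_vector set \<Rightarrow> ('a \<Rightarrow> 'a \<Rightarrow> real) \<Rightarrow> 'a \<Rightarrow> 'a \<Rightarrow> 'a \<Rightarrow> 'a" where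
  "spin_product H ip e x y =
     (THE z. \<exists>a\<in>H. \<exists>b\<in>H. \<exists>\<alpha> \<beta>. x = a + \<alpha> *\<^sub>R e \<and> y = b + \<beta> *\<^sub>R e \<and>
        z = \<beta> *\<^sub>R a + \<alpha> *\<^sub>R b + (ip a b + \<alpha> * \<beta>) *\<^sub>R e)"

definition spin_factor :: "'a::real_vector set \<Rightarrow> 'a \<Rightarrow> bool" where
  "spin_factor C u \<longleftrightarrow>
     dim_at_least TYPE('a) 3 \<and> u \<noteq> 0 \<and>
     (\<exists>H ip.
        hilbert_subspace H ip \<and>
        direct_sum_decomposition H (span {u}) \<and>
        C = range (\<lambda>a. spin_product H ip u a a) \<and>
        (\<forall>a\<in>H. \<forall>\<mu>::real. ou_norm C u (a + \<mu> *\<^sub>R u) = sqrt (ip a a) + \<bar>\<mu>\<bar>))"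

lemma direct_sum_span_unique:
  fixes e :: "'a::real_vector"
  assumes "direct_sum_decomposition H (span {e})" "e \<noteq> 0" "a \<in> H" "a' \<in> H"
    and eq: "a + \<alpha> *\<^sub>R e = a' + \<alpha>' *\<^sub>R e"
  shows "a = a' \<and> \<alpha> = \<alpha>'"
proof -
  have H: "subspace H" "H \<inter> span {e} = {0}"
    using assms(1) by (auto simp: direct_sum_decomposition_def)
  have d: "a - a' = (\<alpha>' - \<alpha>) *\<^sub>R e"
    using eq by (simp add: algebra_simps)
  have "a - a' \<in> H"
    using H(1) assms(3,4) by (rule subspace_diff)
  moreover have "a - a' \<in> span {e}"
    unfolding d by (intro span_scale span_base) simp
  ultimately have "a - a' = 0"
    using H(2) by blast
  with d \<open>e \<noteq> 0\<close> show ?thesis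
    by auto
qed

lemma spin_product_eq:
  fixes e :: "'a::real_vector"
  assumes "direct_sum_decomposition H (span {e})" "e \<noteq> 0" "a \<in> H" "b \<in> H"
  shows "spin_product H ip e (a + \<alpha> *\<^sub>R e) (b + \<beta> *\<^sub>R e) =
    \<beta> *\<^sub>R a + \<alpha> *\<^sub>R b + (ip a b + \<alpha> * \<beta>) *\<^sub>R e"
  unfolding spin_product_def
proof (rule the_equality)
  show "\<exists>a'\<in>H. \<exists>b'\<in>H. \<exists>\<alpha>' \<beta>'. a + \<alpha> *\<^sub>R e = a' + \<alpha>' *\<^sub>R e \<and> b + \<beta> *\<^sub>R e = b' + \<beta>' *\<^sub>R e \<and>
      \<beta> *\<^sub>R a + \<alpha> *\<^sub>R b + (ip a b + \<alpha> * \<beta>) *\<^sub>R e = \<beta>' *\<^sub>R a' + \<alpha>' *\<^sub>R b' + (ip a' b' + \<alpha>' * \<beta>') *\<^sub>R e"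
    using assms(3,4) by blast
next
  fix z
  assume "\<exists>a'\<in>H. \<exists>b'\<in>H. \<exists>\<alpha>' \<beta>'. a + \<alpha> *\<^sub>R e = a' + \<alpha>' *\<^sub>R e \<and> b + \<beta> *\<^sub>R e = b' + \<beta>' *\<^sub>R e \<and>
      z = \<beta>' *\<^sub>R a' + \<alpha>' *\<^sub>R b' + (ip a' b' + \<alpha>' * \<beta>') *\<^sub>R e"
  then obtain a' b' \<alpha>' \<beta>' where *: "a' \<in> H" "b' \<in> H" "a + \<alpha> *\<^sub>R e = a' + \<alpha>' *\<^sub>R e"
      "b + \<beta> *\<^sub>R e = b' + \<beta>' *\<^sub>R e" "z = \<beta>' *\<^sub>R a' + \<alpha>' *\<^sub>R b' + (ip a' b' + \<alpha>' * \<beta>') *\<^sub>R e"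
    by blast
  have "a = a' \<and> \<alpha> = \<alpha>'" "b = b' \<and> \<beta> = \<beta>'"
    using direct_sum_span_unique[OF assms(1,2)] assms(3,4) * by blast+
  with * show "z = \<beta> *\<^sub>R a + \<alpha> *\<^sub>R b + (ip a b + \<alpha> * \<beta>) *\<^sub>R e"
    by simp
qed

end

theory Submission
  imports Defs
begin

text \<open>
  For an interior point \<open>y\<close> of the cone and any vector \<open>v\<close>, let \<open>up y v\<close> and \<open>lo y v\<close> be the least \<open>\<beta>\<close>
  with \<open>v \<le> \<beta> y\<close> and the greatest \<open>\<beta>\<close> with \<open>\<beta> y \<le> v\<close>. In a spin factor with \<open>y = u\<close> these are the two
  eigenvalues of \<open>v\<close>, and their product is the determinant \<open>\<alpha>\<^sup>2 - (a | a)\<close> of \<open>v = a + \<alpha> u\<close>. The whole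
  proof is about the relative determinant \<open>rdet y v = up y v * lo y v\<close>.

  Suppose that an antihomogeneous order-antimorphism \<open>g\<close> exists. A plane through an interior point
  cuts the cone in a quadrant; in the coordinates of that quadrant (\<open>frame\<close>) one has
  \<open>rdet y v = (v\<^sub>1 v\<^sub>2) / (y\<^sub>1 y\<^sub>2)\<close>. The map \<open>g\<close> satisfies \<open>up (g x) (g y) = up y x\<close>, and strict
  convexity makes the equality \<open>up y x = up z x * up y z\<close> hold exactly when \<open>z\<close> is a nonnegative
  combination of \<open>x\<close> and \<open>y\<close>. So \<open>g\<close> maps planes to planes, and in the two quadrants it is
  coordinatewise inversion up to positive factors. This gives the formula (\<open>g_plane\<close>)
  \<open>rdet x (s x + t y) g (s x + t y) = s g(x) + t rdet x y g(y)\<close>.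
  Computing \<open>g (x + y + z)\<close> in three ways, as in Ceva's theorem, gives the cocycle identity
  \<open>rdet x z = rdet x y * rdet y z\<close> (\<open>rdet_cocycle\<close>).

  The cocycle identity says that, on the interior, \<open>Q = rdet u\<close> is up to a factor the product of the two
  coordinates in every plane, not only in the planes that contain \<open>u\<close>. Hence \<open>Q\<close> is quadratic on each
  such plane, and a short computation turns this into a bilinear form \<open>B\<close> on the whole space with
  \<open>B v v = Q v\<close>. On the kernel \<open>H\<close> of \<open>v \<mapsto> B v u\<close> the two eigenvalues are opposite, so \<open>- B v v\<close> is
  the square of the order unit norm of \<open>v\<close>; thus \<open>- B\<close> is the inner product of the spin factor.

  Conversely, a spin factor carries the Jordan inverse, which sends \<open>a + \<alpha> u\<close> to \<open>\<alpha> u - a\<close> divided by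
  \<open>Q (a + \<alpha> u)\<close>. It is an order-antimorphism because
  \<open>Q (inv x - inv y) = Q (y - x) / (Q x Q y)\<close> and the vectors with \<open>Q \<ge> 0\<close> are those in \<open>C\<close> and in \<open>- C\<close>.
\<close>

section \<open>Order unit spaces\<close>

locale ou_space =
  fixes C :: "'a::real_vector set" and u :: 'a
  assumes ou: "order_unit_space C u" and u_nz: "u \<noteq> 0"
begin

lemma C_cone: "cone C" and C_convex: "convex C" and C_pointed: "C \<inter> uminus ` C = {0}"
  using ou by (auto simp: order_unit_space_def archimedean_cone_def pointed_cone_def)

lemma C_scale: "x \<in> C \<Longrightarrow> 0 \<le> c \<Longrightarrow> c *\<^sub>R x \<in> C"
  using C_cone by (simp add: cone_def)

lemma C_add: "x \<in> C \<Longrightarrow> y \<in> C \<Longrightarrow> x + y \<in> C"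
  using C_cone C_convex convex_cone by blast

lemma C_zero: "0 \<in> C"
  using C_pointed by auto

lemma C_antisym: "x \<in> C \<Longrightarrow> - x \<in> C \<Longrightarrow> x = 0"
  using C_pointed by (metis IntI image_eqI minus_minus singletonD)

lemma C_scale_iff: "0 < c \<Longrightarrow> c *\<^sub>R x \<in> C \<longleftrightarrow> x \<in> C"
  using C_scale[of x c] C_scale[of "c *\<^sub>R x" "1 / c"] by auto

lemma u_in_C: "u \<in> C"
  using ou by (auto simp: order_unit_space_def order_unit_def)

lemma order_unit_bound: "\<exists>\<mu>\<ge>0. \<mu> *\<^sub>R u - x \<in> C"
  using ou unfolding order_unit_space_def order_unit_def cone_le_def by blast

lemma C_limit:
  assumes "y \<in> C" and le: "\<And>\<epsilon>. 0 < \<epsilon> \<Longrightarrow> v + \<epsilon> *\<^sub>R y \<in> C"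
  shows "v \<in> C"
proof -
  have "cone_le C (real n *\<^sub>R (- v)) y" if "1 \<le> n" for n :: nat
  proof -
    have "real n *\<^sub>R (v + (1 / real n) *\<^sub>R y) \<in> C"
      using that by (intro C_scale le) auto
    then show ?thesis
      using that by (simp add: cone_le_def scaleR_add_right add.commute)
  qed
  then have "cone_le C (- v) 0"
    using ou \<open>y \<in> C\<close> unfolding order_unit_space_def archimedean_cone_def by blast
  then show ?thesis by (simp add: cone_le_def)
qed

text \<open>
  The interior of the cone; \<open>cone_interior_eq\<close> identifies it with the topological interior. This
  order-theoretic form gives all facts about interior points without the norm.
\<close>

definition K :: "'a set" where
  "K = {x. \<exists>\<epsilon>>0. x - \<epsilon> *\<^sub>R u \<in> C}"

lemma K_in_C: "x \<in> K \<Longrightarrow> x \<in> C"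
proof -
  assume "x \<in> K"
  then obtain \<epsilon> where e: "\<epsilon> > 0" "x - \<epsilon> *\<^sub>R u \<in> C" by (auto simp: K_def)
  have "(x - \<epsilon> *\<^sub>R u) + \<epsilon> *\<^sub>R u \<in> C"
    using e by (intro C_add C_scale u_in_C) auto
  then show ?thesis by simp
qed

lemma u_in_K: "u \<in> K"
proof -
  have "u - (1/2) *\<^sub>R u = (1/2) *\<^sub>R u" by (simp add: algebra_simps flip: scaleR_left_distrib)
  then show ?thesis
    unfolding K_def using C_scale[OF u_in_C, of "1/2"] by (auto intro!: exI[of _ "1/2"])
qed

lemma K_add_C: "x \<in> K \<Longrightarrow> y \<in> C \<Longrightarrow> x + y \<in> K"
proof -
  assume "x \<in> K" "y \<in> C"
  then obtain \<epsilon> where e: "\<epsilon> > 0" "x - \<epsilon> *\<^sub>R u \<in> C" by (auto simp: K_def)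
  then have "(x - \<epsilon> *\<^sub>R u) + y \<in> C" using \<open>y \<in> C\<close> by (intro C_add)
  then show ?thesis using e(1) by (auto simp: K_def algebra_simps)
qed

lemma K_add: "x \<in> K \<Longrightarrow> y \<in> K \<Longrightarrow> x + y \<in> K"
  using K_add_C K_in_C by blast

lemma K_scale: "x \<in> K \<Longrightarrow> 0 < c \<Longrightarrow> c *\<^sub>R x \<in> K"
proof -
  assume "x \<in> K" "0 < c"
  then obtain \<epsilon> where e: "\<epsilon> > 0" "x - \<epsilon> *\<^sub>R u \<in> C" by (auto simp: K_def)
  then have "c *\<^sub>R (x - \<epsilon> *\<^sub>R u) \<in> C" using \<open>0 < c\<close> by (intro C_scale) auto
  then show ?thesis using e(1) \<open>0 < c\<close>
    by (auto simp: K_def algebra_simps intro!: exI[of _ "c * \<epsilon>"])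
qed

lemma K_scale_iff: "0 < c \<Longrightarrow> c *\<^sub>R x \<in> K \<longleftrightarrow> x \<in> K"
  using K_scale[of x c] K_scale[of "c *\<^sub>R x" "1 / c"] by auto

lemma K_nz: "x \<in> K \<Longrightarrow> x \<noteq> 0"
proof
  assume "x \<in> K" "x = 0"
  then obtain \<epsilon> where e: "\<epsilon> > 0" "- (\<epsilon> *\<^sub>R u) \<in> C" by (auto simp: K_def)
  then have "\<epsilon> *\<^sub>R u = 0" using C_antisym C_scale[OF u_in_C, of \<epsilon>] by force
  then show False using u_nz e by simp
qed

lemma K_scale_in_C: "y \<in> K \<Longrightarrow> c *\<^sub>R y \<in> C \<longleftrightarrow> 0 \<le> c"
proof
  assume y: "y \<in> K" and c: "c *\<^sub>R y \<in> C"
  show "0 \<le> c"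
  proof (rule ccontr)
    assume "\<not> 0 \<le> c"
    then have "(1 / - c) *\<^sub>R (c *\<^sub>R y) \<in> C" using C_scale[OF c, of "1 / - c"] by simp
    then have "- y \<in> C" using \<open>\<not> 0 \<le> c\<close> by simp
    then show False using C_antisym K_in_C K_nz y by blast
  qed
qed (simp add: K_in_C C_scale)

lemma K_order_unit:
  assumes "y \<in> K" obtains \<mu> where "0 < \<mu>" "\<mu> *\<^sub>R y - v \<in> C"
proof -
  obtain \<epsilon> where e: "\<epsilon> > 0" "y - \<epsilon> *\<^sub>R u \<in> C" using assms by (auto simp: K_def)
  obtain \<mu> where m: "\<mu> \<ge> 0" "\<mu> *\<^sub>R u - v \<in> C" using order_unit_bound by blast
  have "((\<mu> / \<epsilon>) *\<^sub>R (y - \<epsilon> *\<^sub>R u) + (\<mu> *\<^sub>R u - v)) + y \<in> C"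
    using e m K_in_C[OF assms] by (intro C_add C_scale) auto
  also have "((\<mu> / \<epsilon>) *\<^sub>R (y - \<epsilon> *\<^sub>R u) + (\<mu> *\<^sub>R u - v)) + y = (\<mu> / \<epsilon> + 1) *\<^sub>R y - v"
    using e by (simp add: algebra_simps)
  finally show thesis using that[of "\<mu> / \<epsilon> + 1"] e m
    by (metis add_nonneg_pos divide_nonneg_pos zero_less_one)
qed

definition up :: "'a \<Rightarrow> 'a \<Rightarrow> real" where
  "up y v = Inf {\<beta>. \<beta> *\<^sub>R y - v \<in> C}"

definition lo :: "'a \<Rightarrow> 'a \<Rightarrow> real" where
  "lo y v = - up y (- v)"

text \<open>
  The infimum is attained because the cone is Archimedean. With this equivalence, every later
  property of \<open>up\<close> and \<open>lo\<close> is read off from membership in \<open>C\<close>.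
\<close>

lemma up_le_iff:
  assumes y: "y \<in> K"
  shows "up y v \<le> \<beta> \<longleftrightarrow> \<beta> *\<^sub>R y - v \<in> C"
proof -
  let ?S = "{\<beta>. \<beta> *\<^sub>R y - v \<in> C}"
  have ne: "?S \<noteq> {}" using K_order_unit[OF y] by blast
  obtain \<gamma> where g: "\<gamma> *\<^sub>R y - (- v) \<in> C" using K_order_unit[OF y] by blast
  have bdd: "bdd_below ?S"
  proof (rule bdd_belowI)
    fix \<beta> assume "\<beta> \<in> ?S"
    then have "(\<beta> *\<^sub>R y - v) + (\<gamma> *\<^sub>R y - (- v)) \<in> C" using g by (intro C_add) auto
    then have "(\<beta> + \<gamma>) *\<^sub>R y \<in> C" by (simp add: algebra_simps)
    then show "- \<gamma> \<le> \<beta>" using K_scale_in_C[OF y, of "\<beta> + \<gamma>"] by linarith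
  qed
  have upw: "\<beta>' \<in> ?S" if "\<beta> \<in> ?S" "\<beta> \<le> \<beta>'" for \<beta> \<beta>'
  proof -
    have "(\<beta> *\<^sub>R y - v) + (\<beta>' - \<beta>) *\<^sub>R y \<in> C"
      using that K_in_C[OF y] by (intro C_add C_scale) auto
    then show ?thesis by (simp add: algebra_simps)
  qed
  have Inf_in: "Inf ?S \<in> ?S"
  proof -
    have "(Inf ?S *\<^sub>R y - v) + \<epsilon> *\<^sub>R y \<in> C" if "0 < \<epsilon>" for \<epsilon>
    proof -
      have "Inf ?S < Inf ?S + \<epsilon>" using that by simp
      from cInf_lessD[OF ne this] obtain \<beta> where "\<beta> \<in> ?S" "\<beta> < Inf ?S + \<epsilon>" by blast
      then have "Inf ?S + \<epsilon> \<in> ?S" using upw[of \<beta> "Inf ?S + \<epsilon>"] by simp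
      then show ?thesis by (simp add: algebra_simps)
    qed
    then show ?thesis using C_limit[OF K_in_C[OF y], of "Inf ?S *\<^sub>R y - v"] by simp
  qed
  show ?thesis
    unfolding up_def using upw[OF Inf_in] cInf_lower[OF _ bdd, of \<beta>] by auto
qed

lemma le_lo_iff:
  assumes y: "y \<in> K"
  shows "\<beta> \<le> lo y v \<longleftrightarrow> v - \<beta> *\<^sub>R y \<in> C"
  using up_le_iff[OF y, of "- v" "- \<beta>"] by (auto simp: lo_def)

lemma up_eqI:
  assumes "y \<in> K" "\<And>\<beta>. \<beta> *\<^sub>R y - v \<in> C \<longleftrightarrow> c \<le> \<beta>"
  shows "up y v = c"
  using assms by (metis up_le_iff order.antisym order.refl)

lemma in_K_iff:
  assumes y: "y \<in> K"
  shows "v \<in> K \<longleftrightarrow> (\<exists>\<beta>>0. v - \<beta> *\<^sub>R y \<in> C)"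
proof
  assume "v \<in> K"
  then obtain \<mu> where "0 < \<mu>" "\<mu> *\<^sub>R v - y \<in> C" using K_order_unit by blast
  then have "(1 / \<mu>) *\<^sub>R (\<mu> *\<^sub>R v - y) \<in> C" by (intro C_scale) auto
  then have "v - (1 / \<mu>) *\<^sub>R y \<in> C" using \<open>0 < \<mu>\<close> by (simp add: algebra_simps)
  then show "\<exists>\<beta>>0. v - \<beta> *\<^sub>R y \<in> C" using \<open>0 < \<mu>\<close> by (intro exI[of _ "1 / \<mu>"]) simp
next
  assume "\<exists>\<beta>>0. v - \<beta> *\<^sub>R y \<in> C"
  then obtain \<beta> where "\<beta> > 0" "v - \<beta> *\<^sub>R y \<in> C" by blast
  then have "\<beta> *\<^sub>R y + (v - \<beta> *\<^sub>R y) \<in> K" using K_add_C K_scale[OF y] by blast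
  then show "v \<in> K" by simp
qed

lemma in_K_iff_lo: "y \<in> K \<Longrightarrow> v \<in> K \<longleftrightarrow> 0 < lo y v"
  by (metis in_K_iff le_lo_iff less_le_trans order.refl)

lemma in_C_iff_lo_u: "v \<in> C \<longleftrightarrow> 0 \<le> lo u v"
  using le_lo_iff[OF u_in_K, of 0 v] by simp

lemma up_bound: "y \<in> K \<Longrightarrow> up y v *\<^sub>R y - v \<in> C"
  using up_le_iff by blast

lemma lo_bound: "y \<in> K \<Longrightarrow> v - lo y v *\<^sub>R y \<in> C"
  using le_lo_iff by blast

lemma lo_le_up: "y \<in> K \<Longrightarrow> lo y v \<le> up y v"
proof -
  assume y: "y \<in> K"
  have "(up y v *\<^sub>R y - v) + (v - lo y v *\<^sub>R y) \<in> C"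
    using up_bound lo_bound y by (intro C_add) auto
  then have "(up y v - lo y v) *\<^sub>R y \<in> C" by (simp add: algebra_simps)
  then show ?thesis using K_scale_in_C[OF y] by force
qed

lemma lo_eq_up: "y \<in> K \<Longrightarrow> lo y v = up y v \<Longrightarrow> v = up y v *\<^sub>R y"
  using up_bound[of y v] lo_bound[of y v] C_antisym[of "up y v *\<^sub>R y - v"] by (auto simp: algebra_simps)

text \<open>
  This is what connects \<open>up\<close> to strict convexity: the extremal multiples produce boundary points.
\<close>

lemma up_boundary: "y \<in> K \<Longrightarrow> up y v *\<^sub>R y - v \<notin> K"
proof
  assume y: "y \<in> K" and "up y v *\<^sub>R y - v \<in> K"
  then obtain \<beta> where "\<beta> > 0" "(up y v *\<^sub>R y - v) - \<beta> *\<^sub>R y \<in> C" using in_K_iff by blast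
  then have "(up y v - \<beta>) *\<^sub>R y - v \<in> C" by (simp add: algebra_simps)
  then show False using up_le_iff[OF y, of v "up y v - \<beta>"] \<open>\<beta> > 0\<close> by simp
qed

lemma up_pos: "y \<in> K \<Longrightarrow> v \<in> K \<Longrightarrow> 0 < up y v"
  using in_K_iff_lo[of y v] lo_le_up[of y v] by linarith

lemma up_minus: "up y (- v) = - lo y v"
  by (simp add: lo_def)

lemma lo_minus: "lo y (- v) = - up y v"
  by (simp add: lo_def)

lemma up_shift: "y \<in> K \<Longrightarrow> up y (v + c *\<^sub>R y) = up y v + c"
proof (rule up_eqI)
  fix \<beta> assume y: "y \<in> K"
  have "\<beta> *\<^sub>R y - (v + c *\<^sub>R y) = (\<beta> - c) *\<^sub>R y - v" by (simp add: algebra_simps)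
  then show "(\<beta> *\<^sub>R y - (v + c *\<^sub>R y) \<in> C) = (up y v + c \<le> \<beta>)"
    using up_le_iff[OF y, of v "\<beta> - c"] by (metis le_diff_eq)
qed

lemma lo_shift: "y \<in> K \<Longrightarrow> lo y (v + c *\<^sub>R y) = lo y v + c"
  using up_shift[of y "- v" "- c"] by (simp add: lo_def)

lemma up_scale: "y \<in> K \<Longrightarrow> 0 < c \<Longrightarrow> up y (c *\<^sub>R v) = c * up y v"
proof (rule up_eqI)
  fix \<beta> assume y: "y \<in> K" and c: "0 < c"
  have "\<beta> *\<^sub>R y - c *\<^sub>R v = c *\<^sub>R ((\<beta> / c) *\<^sub>R y - v)" using c by (simp add: algebra_simps)
  then have "(\<beta> *\<^sub>R y - c *\<^sub>R v \<in> C) = (up y v \<le> \<beta> / c)"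
    using C_scale_iff[OF c] up_le_iff[OF y] by metis
  then show "(\<beta> *\<^sub>R y - c *\<^sub>R v \<in> C) = (c * up y v \<le> \<beta>)"
    using c by (simp add: field_simps)
qed

lemma lo_scale: "y \<in> K \<Longrightarrow> 0 < c \<Longrightarrow> lo y (c *\<^sub>R v) = c * lo y v"
  using up_scale[of y c "- v"] by (simp add: lo_def)

lemma up_zero: "y \<in> K \<Longrightarrow> up y 0 = 0"
  using K_scale_in_C by (intro up_eqI) auto

lemma up_add: "y \<in> K \<Longrightarrow> up y (v + w) \<le> up y v + up y w"
proof -
  assume y: "y \<in> K"
  have "(up y v *\<^sub>R y - v) + (up y w *\<^sub>R y - w) \<in> C" using up_bound[OF y] by (intro C_add)
  then show ?thesis using up_le_iff[OF y] by (simp add: algebra_simps)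
qed

section \<open>Determinant and trace relative to interior points\<close>

text \<open>
  In the decomposition of \<open>v\<close> in a spin factor, \<open>up u v\<close> and \<open>lo u v\<close> are the two eigenvalues of
  \<open>v\<close>. The relative determinant is their product for a general base point \<open>y\<close>, and \<open>trc\<close> is half
  the trace, that is, the coefficient of \<open>u\<close>.
\<close>

definition rdet :: "'a \<Rightarrow> 'a \<Rightarrow> real" where "rdet y v = up y v * lo y v"

abbreviation Q :: "'a \<Rightarrow> real" where "Q \<equiv> rdet u"

definition trc :: "'a \<Rightarrow> real" where "trc v = (up u v + lo u v) / 2"

lemma rdet_pos: "x \<in> K \<Longrightarrow> y \<in> K \<Longrightarrow> 0 < rdet x y"
  using up_pos[of x y] in_K_iff_lo[of x y] by (simp add: rdet_def)

lemma Q_minus: "Q (- v) = Q v"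
  by (simp add: rdet_def up_minus lo_minus)

lemma Q_scale_pos: "0 < s \<Longrightarrow> Q (s *\<^sub>R v) = s\<^sup>2 * Q v"
  by (simp add: rdet_def up_scale lo_scale u_in_K power2_eq_square)

lemma Q_zero: "Q 0 = 0"
  by (simp add: rdet_def up_zero u_in_K)

text \<open>
  Shifting by a multiple of \<open>u\<close> moves both eigenvalues by the same amount, so \<open>Q\<close> is quadratic along
  \<open>u\<close> for every vector; interior statements extend from \<open>K\<close> to the whole space by such shifts.
\<close>

lemma Q_shift: "Q (v + c *\<^sub>R u) = Q v + 2 * c * trc v + c\<^sup>2"
  by (simp add: rdet_def up_shift lo_shift u_in_K trc_def algebra_simps power2_eq_square)

lemma trc_shift: "trc (v + c *\<^sub>R u) = trc v + c"
  by (simp add: trc_def up_shift lo_shift u_in_K)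

lemma trc_minus: "trc (- v) = - trc v"
  by (simp add: trc_def up_minus lo_minus minus_divide_left)

lemma trc_scale_pos: "0 < s \<Longrightarrow> trc (s *\<^sub>R v) = s * trc v"
  by (simp add: trc_def up_scale lo_scale u_in_K algebra_simps)

lemma trc_zero: "trc 0 = 0"
  using trc_minus[of 0] by simp

lemma trc_u: "trc u = 1"
  using trc_shift[of 0 1] by (simp add: trc_zero)

section \<open>The order unit norm and its topology\<close>

lemma ou_norm_eq: "ou_norm C u x = max (up u x) (up u (- x))"
proof -
  let ?N = "max (up u x) (up u (- x))"
  have N0: "0 \<le> ?N" using lo_le_up[OF u_in_K, of x] by (auto simp: lo_def)
  have "cone_le C (- (\<mu> *\<^sub>R u)) x \<and> cone_le C x (\<mu> *\<^sub>R u) \<longleftrightarrow> ?N \<le> \<mu>" for \<mu>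
    using up_le_iff[OF u_in_K, of x \<mu>] up_le_iff[OF u_in_K, of "- x" \<mu>]
    by (auto simp: cone_le_def add.commute)
  then have eq: "ou_norm C u x = Inf {\<mu>. 0 < \<mu> \<and> ?N \<le> \<mu>}"
    unfolding ou_norm_def by presburger
  show ?thesis
  proof (cases "?N = 0")
    case True
    \<comment> \<open>For \<open>x = 0\<close> the infimum over \<open>\<mu> > 0\<close> is not attained.\<close>
    then have "{\<mu>. 0 < \<mu> \<and> ?N \<le> \<mu>} = {0<..}" by auto
    then show ?thesis using eq True by simp
  next
    case False
    then have "{\<mu>. 0 < \<mu> \<and> ?N \<le> \<mu>} = {?N..}" using N0 by auto
    then show ?thesis using eq by simp
  qed
qed

lemma ou_norm_le_iff: "ou_norm C u x \<le> \<mu> \<longleftrightarrow> \<mu> *\<^sub>R u - x \<in> C \<and> \<mu> *\<^sub>R u + x \<in> C"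
  using up_le_iff[OF u_in_K, of x \<mu>] up_le_iff[OF u_in_K, of "- x" \<mu>] by (simp add: ou_norm_eq)

lemma ou_norm_minus: "ou_norm C u (- x) = ou_norm C u x"
  by (simp add: ou_norm_eq max.commute)

lemma ou_norm_nonneg: "0 \<le> ou_norm C u x"
  using lo_le_up[OF u_in_K, of x] by (auto simp: lo_def ou_norm_eq)

lemma ou_norm_triangle: "ou_norm C u (x + y) \<le> ou_norm C u x + ou_norm C u y"
  using up_add[OF u_in_K, of x y] up_add[OF u_in_K, of "- x" "- y"] by (auto simp: ou_norm_eq)

lemma ou_norm_zero_iff: "ou_norm C u x = 0 \<longleftrightarrow> x = 0"
proof
  assume "ou_norm C u x = 0"
  then have "0 *\<^sub>R u - x \<in> C \<and> 0 *\<^sub>R u + x \<in> C" using ou_norm_le_iff by (metis order.refl)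
  then show "x = 0" using C_antisym by simp
qed (simp add: ou_norm_eq up_zero u_in_K)

sublocale ouM: Metric_space UNIV "ou_dist C u"
proof
  fix x y z
  show "0 \<le> ou_dist C u x y" by (simp add: ou_dist_def ou_norm_nonneg)
  show "ou_dist C u x y = ou_dist C u y x"
    using ou_norm_minus[of "x - y"] by (simp add: ou_dist_def)
  show "(ou_dist C u x y = 0) = (x = y)" by (simp add: ou_dist_def ou_norm_zero_iff)
  show "ou_dist C u x z \<le> ou_dist C u x y + ou_dist C u y z"
    using ou_norm_triangle[of "x - y" "y - z"] by (simp add: ou_dist_def)
qed

lemma cone_interior_eq: "cone_interior C u = K"
proof -
  have "(\<exists>r>0. ouM.mball x r \<subseteq> C) \<longleftrightarrow> x \<in> K" for x
  proof
    assume "\<exists>r>0. ouM.mball x r \<subseteq> C"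
    then obtain r where r: "r > 0" "ouM.mball x r \<subseteq> C" by blast
    have "ou_norm C u ((r/2) *\<^sub>R u) \<le> r / 2"
      unfolding ou_norm_le_iff using r C_scale[OF u_in_C, of r] C_zero
      by (simp flip: scaleR_left_distrib)
    then have "x - (r/2) *\<^sub>R u \<in> ouM.mball x r" using r by (simp add: ou_dist_def)
    then show "x \<in> K" using r unfolding K_def by (auto intro!: exI[of _ "r/2"])
  next
    assume "x \<in> K"
    then obtain \<epsilon> where e: "\<epsilon> > 0" "x - \<epsilon> *\<^sub>R u \<in> C" by (auto simp: K_def)
    have "y \<in> C" if "ou_norm C u (x - y) < \<epsilon>" for y
    proof -
      have "(x - \<epsilon> *\<^sub>R u) + (\<epsilon> *\<^sub>R u - (x - y)) \<in> C"
        using e that ou_norm_le_iff[of "x - y" \<epsilon>] by (intro C_add) auto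
      then show ?thesis by simp
    qed
    then show "\<exists>r>0. ouM.mball x r \<subseteq> C" using e(1) by (auto simp: ou_dist_def)
  qed
  then show ?thesis
    unfolding cone_interior_def ou_topology_def by (auto simp: ouM.metric_interior_of)
qed

lemma C_closed: "closedin ouM.mtopology C"
proof -
  have "\<exists>r>0. ouM.mball v r \<subseteq> - C" if v: "v \<notin> C" for v
  proof -
    obtain \<epsilon> where e: "\<epsilon> > 0" "v + \<epsilon> *\<^sub>R u \<notin> C" using C_limit[OF u_in_C, of v] v by blast
    have "y \<notin> C" if "ou_norm C u (v - y) < \<epsilon>" for y
    proof
      assume "y \<in> C"
      then have "y + (\<epsilon> *\<^sub>R u + (v - y)) \<in> C"
        using that ou_norm_le_iff[of "v - y" \<epsilon>] C_add less_imp_le by blast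
      then show False using e by (simp add: add.commute)
    qed
    then show ?thesis using e(1) by (auto simp: ou_dist_def)
  qed
  then show ?thesis by (auto simp: closedin_def ouM.openin_mtopology Compl_eq_Diff_UNIV)
qed

lemma cone_boundary_eq: "cone_boundary C u = C - K"
  using C_closed cone_interior_eq closure_of_eq[of ouM.mtopology C]
  unfolding cone_boundary_def cone_interior_def ou_topology_def frontier_of_def by simp

end

section \<open>Planes and geodesics in a strictly convex cone\<close>

locale strict_ou_space = ou_space +
  assumes strict: "strictly_convex_cone C u"
    and big: "dim_at_least TYPE('a) 3"
begin

text \<open>
  Two boundary points whose sum is again on the boundary lie on one ray. The midpoint of an
  independent pair would be interior by strict convexity.
\<close>

lemma boundary_sum:
  assumes p: "p \<in> C" "p \<notin> K" and q: "q \<in> C" "q \<notin> K" and s: "p + q \<notin> K" and nz: "p \<noteq> 0" "q \<noteq> 0"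
  obtains t where "0 < t" "q = t *\<^sub>R p"
proof -
  have "q \<in> span {p}"
  proof (rule ccontr)
    assume "q \<notin> span {p}"
    moreover have "independent {p}" using nz by (simp add: independent_insert)
    ultimately have ind: "independent {p, q}" "p \<noteq> q"
      by (auto simp: insert_commute[of p q] independent_insert span_base)
    have "p \<in> C - K" "q \<in> C - K" using p q by auto
    from strict[unfolded strictly_convex_cone_def cone_boundary_eq cone_interior_eq,
        rule_format, OF this conjI[OF ind(2) ind(1)]]
    have seg: "{(1 - \<mu>) *\<^sub>R p + \<mu> *\<^sub>R q | \<mu>::real. 0 < \<mu> \<and> \<mu> < 1} \<subseteq> K" .
    have "(1 - 1/2) *\<^sub>R p + (1/2::real) *\<^sub>R q \<in> K"
      by (rule subsetD[OF seg], rule CollectI, rule exI[of _ "1/2"]) simp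
    then have "(1/2) *\<^sub>R (p + q) \<in> K" by (simp add: scaleR_add_right)
    then show False using K_scale_iff[of "1/2" "p + q"] s by simp
  qed
  then obtain t where t: "q = t *\<^sub>R p" by (auto simp: span_singleton)
  moreover have "t > 0"
  proof (rule ccontr)
    assume "\<not> 0 < t"
    then have "t < 0" using nz t by (cases "t = 0") auto
    then have "(1 / - t) *\<^sub>R q \<in> C" using C_scale[OF q(1), of "1 / - t"] by simp
    then have "- p \<in> C" using t \<open>t < 0\<close> by simp
    then show False using C_antisym p nz by blast
  qed
  ultimately show thesis using that by blast
qed

definition conic_between :: "'a \<Rightarrow> 'a \<Rightarrow> 'a \<Rightarrow> bool" where
  "conic_between x z y \<longleftrightarrow> (\<exists>\<alpha>\<ge>0. \<exists>\<beta>\<ge>0. z = \<alpha> *\<^sub>R x + \<beta> *\<^sub>R y)"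

lemma conic_between_commute: "conic_between x z y \<longleftrightarrow> conic_between y z x"
  unfolding conic_between_def by (metis add.commute)

text \<open>
  The logarithm of \<open>up\<close> is an asymmetric metric on the interior, with triangle inequality
  \<open>up y x \<le> up z x * up y z\<close>. In the equality case the boundary points \<open>up z x z - x\<close> and
  \<open>up y z y - z\<close> add up, after scaling the second one, to the boundary point \<open>up y x y - x\<close>, so they
  are proportional; this is a linear relation between \<open>x\<close>, \<open>z\<close> and \<open>y\<close>.
\<close>

lemma geodesic_imp_conic_between:
  assumes K: "x \<in> K" "y \<in> K" "z \<in> K" and eq: "up y x = up z x * up y z"
  shows "conic_between x z y"
proof -
  define p where "p = up z x *\<^sub>R z - x"
  define q where "q = up y z *\<^sub>R y - z"
  have pos: "up z x > 0" "up y z > 0" using up_pos K by auto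
  have p: "p \<in> C" "p \<notin> K" using up_bound up_boundary K by (auto simp: p_def)
  have q: "q \<in> C" "q \<notin> K" using up_bound up_boundary K by (auto simp: q_def)
  have "p + up z x *\<^sub>R q = up y x *\<^sub>R y - x" by (simp add: p_def q_def eq algebra_simps)
  then have s: "p + up z x *\<^sub>R q \<notin> K" using up_boundary K by simp
  consider "p = 0" | "q = 0" | "p \<noteq> 0" "q \<noteq> 0" by blast
  then show ?thesis
  proof cases
    case 1
    then have "x = up z x *\<^sub>R z" by (simp add: p_def)
    then have "(1 / up z x) *\<^sub>R x = (1 / up z x) *\<^sub>R (up z x *\<^sub>R z)" by simp
    then have "z = (1 / up z x) *\<^sub>R x + 0 *\<^sub>R y"
      using pos by simp
    then show ?thesis unfolding conic_between_def using pos
      by (meson less_eq_real_def zero_le_divide_1_iff)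
  next
    case 2
    then have "z = 0 *\<^sub>R x + up y z *\<^sub>R y" by (simp add: q_def)
    then show ?thesis unfolding conic_between_def using pos by (meson less_eq_real_def order.refl)
  next
    case 3
    have q': "up z x *\<^sub>R q \<in> C" "up z x *\<^sub>R q \<notin> K" using q pos C_scale_iff K_scale_iff by auto
    then obtain t where t: "t > 0" "up z x *\<^sub>R q = t *\<^sub>R p"
      using boundary_sum[OF p q' s] 3 pos by (metis less_irrefl scaleR_eq_0_iff)
    then have "(up z x + t * up z x) *\<^sub>R z = (up z x * up y z) *\<^sub>R y + t *\<^sub>R x"
      by (simp add: p_def q_def algebra_simps)
    moreover have pp: "up z x + t * up z x > 0" using t(1) pos by (simp add: add_pos_pos)
    ultimately have "(1 / (up z x + t * up z x)) *\<^sub>R (up z x + t * up z x) *\<^sub>R z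
      = (1 / (up z x + t * up z x)) *\<^sub>R ((up z x * up y z) *\<^sub>R y + t *\<^sub>R x)" by simp
    then have "z = (t / (up z x + t * up z x)) *\<^sub>R x + ((up z x * up y z) / (up z x + t * up z x)) *\<^sub>R y"
      using pp by (simp add: scaleR_add_right add.commute)
    moreover have "0 \<le> t / (up z x + t * up z x)" "0 \<le> (up z x * up y z) / (up z x + t * up z x)"
      using pp pos t(1) by simp_all
    ultimately show ?thesis unfolding conic_between_def by blast
  qed
qed

text \<open>
  Generators of the two extreme rays of the quadrant that a plane through the interior cuts out of the
  cone.
\<close>

definition frame :: "'a \<Rightarrow> 'a \<Rightarrow> bool" where
  "frame e f \<longleftrightarrow> (\<forall>a b. (a *\<^sub>R e + b *\<^sub>R f \<in> C \<longleftrightarrow> 0 \<le> a \<and> 0 \<le> b) \<and>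
                         (a *\<^sub>R e + b *\<^sub>R f \<in> K \<longleftrightarrow> 0 < a \<and> 0 < b))"

lemma frame_C: "frame e f \<Longrightarrow> a *\<^sub>R e + b *\<^sub>R f \<in> C \<longleftrightarrow> 0 \<le> a \<and> 0 \<le> b"
  and frame_K: "frame e f \<Longrightarrow> a *\<^sub>R e + b *\<^sub>R f \<in> K \<longleftrightarrow> 0 < a \<and> 0 < b"
  by (simp_all only: frame_def)

lemma frame_swap:
  assumes "frame e f"
  shows "frame f e"
  unfolding frame_def
proof (intro allI)
  fix a b
  have "a *\<^sub>R f + b *\<^sub>R e = b *\<^sub>R e + a *\<^sub>R f" by (rule add.commute)
  then show "(a *\<^sub>R f + b *\<^sub>R e \<in> C \<longleftrightarrow> 0 \<le> a \<and> 0 \<le> b) \<and> (a *\<^sub>R f + b *\<^sub>R e \<in> K \<longleftrightarrow> 0 < a \<and> 0 < b)"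
    using frame_C[OF assms] frame_K[OF assms] by metis
qed

text \<open>
  The extreme rays of the plane through \<open>y\<close> and \<open>w\<close> are spanned by \<open>w - lo y w y\<close> and \<open>up y w y - w\<close>;
  the common scaling by \<open>up y w - lo y w\<close> makes them add up to \<open>y\<close>.
\<close>

lemma frame_exists_aux:
  assumes y: "y \<in> K" and w: "w \<notin> span {y}"
  obtains e f where "frame e f" "y = e + f" "w = up y w *\<^sub>R e + lo y w *\<^sub>R f"
proof -
  define M m d where "M = up y w" and "m = lo y w" and "d = M - m"
  have "m < M"
  proof -
    have "w \<noteq> up y w *\<^sub>R y" using w by (metis span_base span_scale singletonI)
    then have "lo y w \<noteq> up y w" using lo_eq_up[OF y, of w] by blast
    then show ?thesis using lo_le_up[OF y, of w] by (simp add: M_def m_def)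
  qed
  then have d: "d > 0" by (simp add: d_def)
  define e where "e = (1 / d) *\<^sub>R (w - m *\<^sub>R y)"
  define f where "f = (1 / d) *\<^sub>R (M *\<^sub>R y - w)"
  have de: "d *\<^sub>R e = w - m *\<^sub>R y" "d *\<^sub>R f = M *\<^sub>R y - w" using d by (auto simp: e_def f_def)
  have cancel: "v = v'" if "d *\<^sub>R v = d *\<^sub>R v'" for v v' :: 'a using that d by simp
  have yef: "y = e + f"
  proof (rule cancel)
    have "d *\<^sub>R (e + f) = d *\<^sub>R e + d *\<^sub>R f" by (rule scaleR_add_right)
    also have "\<dots> = d *\<^sub>R y" unfolding de by (simp add: d_def scaleR_diff_left)
    finally show "d *\<^sub>R y = d *\<^sub>R (e + f)" ..
  qed
  have wef: "w = M *\<^sub>R e + m *\<^sub>R f"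
  proof (rule cancel)
    have "d *\<^sub>R (M *\<^sub>R e + m *\<^sub>R f) = M *\<^sub>R (d *\<^sub>R e) + m *\<^sub>R (d *\<^sub>R f)" by (simp add: algebra_simps)
    also have "\<dots> = d *\<^sub>R w" unfolding de by (simp add: d_def algebra_simps)
    finally show "d *\<^sub>R w = d *\<^sub>R (M *\<^sub>R e + m *\<^sub>R f)" ..
  qed
  have eC: "e \<in> C" "f \<in> C"
    using up_bound[OF y, of w] lo_bound[OF y, of w] d C_scale[of _ "1 / d"]
    by (auto simp: e_def f_def M_def m_def)
  have C: "a *\<^sub>R e + b *\<^sub>R f \<in> C \<longleftrightarrow> 0 \<le> a \<and> 0 \<le> b" for a b
  proof
    assume ab: "a *\<^sub>R e + b *\<^sub>R f \<in> C"
    have "d *\<^sub>R (a *\<^sub>R e + b *\<^sub>R f) = a *\<^sub>R (d *\<^sub>R e) + b *\<^sub>R (d *\<^sub>R f)" by (simp add: algebra_simps)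
    also have "\<dots> = (a - b) *\<^sub>R w + (b * M - a * m) *\<^sub>R y" unfolding de by (simp add: algebra_simps)
    finally have mem: "(a - b) *\<^sub>R w + (b * M - a * m) *\<^sub>R y \<in> C" using C_scale[OF ab, of d] d by simp
    consider "a = b" | "a > b" | "a < b" by linarith
    then show "0 \<le> a \<and> 0 \<le> b"
    proof cases
      case 1
      then have "a *\<^sub>R y \<in> C" using ab by (simp add: yef scaleR_add_right)
      then show ?thesis using 1 K_scale_in_C[OF y] by simp
    next
      case 2
      have "(1 / (a - b)) *\<^sub>R ((a - b) *\<^sub>R w + (b * M - a * m) *\<^sub>R y) = w - ((a * m - b * M) / (a - b)) *\<^sub>R y"
      proof -
        have "(1 / (a - b)) *\<^sub>R ((b * M - a * m) *\<^sub>R y) = - (((a * m - b * M) / (a - b)) *\<^sub>R y)"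
          unfolding scaleR_scaleR scaleR_minus_left[symmetric] using 2
          by (intro arg_cong2[of _ _ _ _ scaleR]) (auto simp: field_simps)
        then show ?thesis using 2 by (simp add: scaleR_add_right)
      qed
      then have "w - ((a * m - b * M) / (a - b)) *\<^sub>R y \<in> C" using C_scale[OF mem, of "1 / (a - b)"] 2 by simp
      then have "(a * m - b * M) / (a - b) \<le> m" using le_lo_iff[OF y] by (simp add: m_def)
      then have "0 \<le> b * d" using 2 by (simp add: field_simps d_def)
      then have "0 \<le> b" using d by (simp add: zero_le_mult_iff)
      then show ?thesis using 2 by simp
    next
      case 3
      have "(1 / (b - a)) *\<^sub>R ((a - b) *\<^sub>R w + (b * M - a * m) *\<^sub>R y) = ((b * M - a * m) / (b - a)) *\<^sub>R y - w"
      proof -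
        have "(1 / (b - a)) *\<^sub>R ((a - b) *\<^sub>R w) = (- 1) *\<^sub>R w"
          unfolding scaleR_scaleR using 3 by (intro arg_cong2[of _ _ _ _ scaleR]) (auto simp: field_simps)
        then show ?thesis by (simp add: scaleR_add_right)
      qed
      then have "((b * M - a * m) / (b - a)) *\<^sub>R y - w \<in> C" using C_scale[OF mem, of "1 / (b - a)"] 3 by simp
      then have "M \<le> (b * M - a * m) / (b - a)" using up_le_iff[OF y] by (simp add: M_def)
      then have "0 \<le> a * d" using 3 by (simp add: field_simps d_def)
      then have "0 \<le> a" using d by (simp add: zero_le_mult_iff)
      then show ?thesis using 3 by simp
    qed
  next
    assume "0 \<le> a \<and> 0 \<le> b"
    then show "a *\<^sub>R e + b *\<^sub>R f \<in> C" using eC C_add C_scale by blast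
  qed
  have Kk: "a *\<^sub>R e + b *\<^sub>R f \<in> K \<longleftrightarrow> 0 < a \<and> 0 < b" for a b
  proof -
    have "a *\<^sub>R e + b *\<^sub>R f - \<beta> *\<^sub>R y = (a - \<beta>) *\<^sub>R e + (b - \<beta>) *\<^sub>R f" for \<beta>
      by (simp add: yef algebra_simps)
    then have "a *\<^sub>R e + b *\<^sub>R f \<in> K \<longleftrightarrow> (\<exists>\<beta>>0. \<beta> \<le> a \<and> \<beta> \<le> b)"
      using in_K_iff[OF y, of "a *\<^sub>R e + b *\<^sub>R f"] C by auto
    also have "\<dots> \<longleftrightarrow> 0 < a \<and> 0 < b"
      by (auto intro!: exI[of _ "min a b"])
    finally show ?thesis .
  qed
  have "frame e f" unfolding frame_def using C Kk by blast
  from that[OF this yef wef[unfolded M_def m_def]] show thesis .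
qed

lemma not_line: "\<exists>w::'a. w \<notin> span {y}"
proof (rule ccontr)
  assume "\<nexists>w::'a. w \<notin> span {y}"
  then have U: "span {y} = UNIV" by blast
  obtain B :: "'a set" where B: "independent B" "infinite B \<or> 3 \<le> card B"
    using big by (auto simp: dim_at_least_def)
  have "finite B \<and> card B \<le> card {y}"
    using independent_span_bound[OF _ B(1), of "{y}"] U by auto
  then show False using B(2) by auto
qed

text \<open>
  If \<open>w\<close> is a multiple of \<open>y\<close>, any plane through \<open>y\<close> serves, so that later arguments need no separate
  treatment of proportional vectors.
\<close>

lemma frame_exists:
  assumes y: "y \<in> K"
  obtains e f y1 y2 w1 w2 where "frame e f" "y = y1 *\<^sub>R e + y2 *\<^sub>R f" "w = w1 *\<^sub>R e + w2 *\<^sub>R f" "0 < y1" "0 < y2"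
proof (cases "w \<in> span {y}")
  case True
  then obtain c where c: "w = c *\<^sub>R y" by (auto simp: span_singleton)
  obtain w' where "w' \<notin> span {y}" using not_line by blast
  then obtain e f where "frame e f" "y = e + f" using frame_exists_aux[OF y] by blast
  then show thesis using that[of e f 1 1 c c] c by (simp add: scaleR_add_right)
next
  case False
  then obtain e f where F: "frame e f" and y': "y = e + f" and w': "w = up y w *\<^sub>R e + lo y w *\<^sub>R f"
    using frame_exists_aux[OF y] by blast
  have "y = 1 *\<^sub>R e + 1 *\<^sub>R f" by (simp add: y')
  from that[OF F this w'] show thesis by simp
qed

lemma up_frame:
  assumes F: "frame e f" and p: "0 < y1" "0 < y2"
  shows "up (y1 *\<^sub>R e + y2 *\<^sub>R f) (v1 *\<^sub>R e + v2 *\<^sub>R f) = max (v1 / y1) (v2 / y2)"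
proof (rule up_eqI)
  show "y1 *\<^sub>R e + y2 *\<^sub>R f \<in> K" using frame_K[OF F] p by simp
  fix \<beta>
  have "\<beta> *\<^sub>R (y1 *\<^sub>R e + y2 *\<^sub>R f) - (v1 *\<^sub>R e + v2 *\<^sub>R f) = (\<beta> * y1 - v1) *\<^sub>R e + (\<beta> * y2 - v2) *\<^sub>R f"
    by (simp add: scaleR_add_right scaleR_diff_left)
  then show "(\<beta> *\<^sub>R (y1 *\<^sub>R e + y2 *\<^sub>R f) - (v1 *\<^sub>R e + v2 *\<^sub>R f) \<in> C) = (max (v1 / y1) (v2 / y2) \<le> \<beta>)"
    using p by (simp only: frame_C[OF F]) (simp add: field_simps)
qed

lemma lo_frame:
  assumes F: "frame e f" and p: "0 < y1" "0 < y2"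
  shows "lo (y1 *\<^sub>R e + y2 *\<^sub>R f) (v1 *\<^sub>R e + v2 *\<^sub>R f) = min (v1 / y1) (v2 / y2)"
  using up_frame[OF F p, of "- v1" "- v2"] by (simp add: lo_def minus_max_eq_min)

lemma rdet_frame:
  assumes F: "frame e f" and p: "0 < y1" "0 < y2"
  shows "rdet (y1 *\<^sub>R e + y2 *\<^sub>R f) (v1 *\<^sub>R e + v2 *\<^sub>R f) = (v1 * v2) / (y1 * y2)"
  unfolding rdet_def up_frame[OF assms] lo_frame[OF assms] by (simp add: max_def min_def mult.commute)

text \<open>
  In coordinates, the maximum that defines \<open>up\<close> is attained at the same coordinate for all three
  pairs, because the slope of \<open>z\<close> is between those of \<open>x\<close> and \<open>y\<close>.
\<close>

lemma conic_between_imp_geodesic: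
  assumes K: "x \<in> K" "y \<in> K" "z \<in> K" and b: "conic_between x z y"
  shows "up y x = up z x * up y z"
proof -
  obtain \<alpha> \<beta> where ab: "\<alpha> \<ge> 0" "\<beta> \<ge> 0" "z = \<alpha> *\<^sub>R x + \<beta> *\<^sub>R y" using b by (auto simp: conic_between_def)
  obtain e f x1 x2 y1 y2 where F: "frame e f" and x: "x = x1 *\<^sub>R e + x2 *\<^sub>R f" and y: "y = y1 *\<^sub>R e + y2 *\<^sub>R f"
    and xp: "0 < x1" "0 < x2" using frame_exists[OF K(1)] by metis
  have yp: "0 < y1" "0 < y2" using frame_K[OF F] K y by auto
  define z1 z2 where "z1 = \<alpha> * x1 + \<beta> * y1" and "z2 = \<alpha> * x2 + \<beta> * y2"
  have z: "z = z1 *\<^sub>R e + z2 *\<^sub>R f" by (simp add: ab x y z1_def z2_def algebra_simps)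
  have zp: "0 < z1" "0 < z2" using frame_K[OF F] K z by auto
  have *: "x2 * z1 \<le> x1 * z2 \<and> z2 * y1 \<le> z1 * y2" if "x2 * y1 \<le> x1 * y2"
    using mult_left_mono[OF that, of \<alpha>] mult_left_mono[OF that, of \<beta>] ab by (auto simp: z1_def z2_def algebra_simps)
  have **: "x1 * z2 \<le> x2 * z1 \<and> z1 * y2 \<le> z2 * y1" if "x1 * y2 \<le> x2 * y1"
    using mult_left_mono[OF that, of \<alpha>] mult_left_mono[OF that, of \<beta>] ab by (auto simp: z1_def z2_def algebra_simps)
  show ?thesis
  proof (cases "x2 * y1 \<le> x1 * y2")
    case True
    then have "max (x1 / y1) (x2 / y2) = x1 / y1" "max (x1 / z1) (x2 / z2) = x1 / z1"
      "max (z1 / y1) (z2 / y2) = z1 / y1" using *[OF True] xp yp zp by (auto simp: max_def field_simps)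
    then show ?thesis unfolding x y z up_frame[OF F yp] up_frame[OF F zp] using zp by simp
  next
    case False
    then have *: "x1 * z2 \<le> x2 * z1 \<and> z1 * y2 \<le> z2 * y1" using ** by simp
    have "max (x1 / y1) (x2 / y2) = x2 / y2" "max (x1 / z1) (x2 / z2) = x2 / z2"
      "max (z1 / y1) (z2 / y2) = z2 / y2" using * False xp yp zp by (auto simp: max_def field_simps)
    then show ?thesis unfolding x y z up_frame[OF F yp] up_frame[OF F zp] using zp by simp
  qed
qed

lemma dependent_imp_between_aux:
  assumes "a *\<^sub>R x + b *\<^sub>R y + c *\<^sub>R z = 0" "a < 0" "0 \<le> b" "0 \<le> c"
  shows "conic_between y x z"
proof -
  have "(- a) *\<^sub>R x = b *\<^sub>R y + c *\<^sub>R z"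
    using assms(1) by (simp add: minus_unique add.assoc)
  then have "(1 / (- a)) *\<^sub>R ((- a) *\<^sub>R x) = (1 / (- a)) *\<^sub>R (b *\<^sub>R y + c *\<^sub>R z)" by (rule arg_cong)
  moreover have "(1 / (- a)) *\<^sub>R ((- a) *\<^sub>R x) = x" using assms(2) by simp
  ultimately have "x = (1 / (- a)) *\<^sub>R (b *\<^sub>R y + c *\<^sub>R z)" by metis
  then have "x = (b / (- a)) *\<^sub>R y + (c / (- a)) *\<^sub>R z"
    unfolding scaleR_add_right scaleR_scaleR by (simp only: times_divide_eq_left mult_1)
  moreover have "0 \<le> b / (- a)" "0 \<le> c / (- a)" using assms by (simp_all add: divide_nonneg_neg)
  ultimately show ?thesis unfolding conic_between_def by blast
qed

lemma K_nonneg_comb: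
  assumes "x \<in> K" "y \<in> K" "z \<in> K" "a *\<^sub>R x + b *\<^sub>R y + c *\<^sub>R z = 0" "0 \<le> a" "0 \<le> b" "0 \<le> c"
  shows "a = 0 \<and> b = 0 \<and> c = 0"
proof -
  have C: "a *\<^sub>R x \<in> C" "b *\<^sub>R y \<in> C" "c *\<^sub>R z \<in> C" using assms K_in_C C_scale by auto
  have "- (a *\<^sub>R x) = b *\<^sub>R y + c *\<^sub>R z" "- (b *\<^sub>R y) = a *\<^sub>R x + c *\<^sub>R z" "- (c *\<^sub>R z) = a *\<^sub>R x + b *\<^sub>R y"
    using assms(4) by (auto intro!: minus_unique simp: add_ac)
  then have "a *\<^sub>R x = 0" "b *\<^sub>R y = 0" "c *\<^sub>R z = 0" using C C_add C_antisym by metis+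
  then show ?thesis using K_nz assms by simp
qed

text \<open>
  A relation between interior points has coefficients of both signs; solving for the vector whose
  coefficient has the minority sign exhibits it as a nonnegative combination of the other two.
\<close>

lemma dependent_imp_between:
  assumes K: "x \<in> K" "y \<in> K" "z \<in> K" and eq: "a *\<^sub>R x + b *\<^sub>R y + c *\<^sub>R z = 0"
    and nz: "\<not> (a = 0 \<and> b = 0 \<and> c = 0)"
  shows "conic_between y x z \<or> conic_between x y z \<or> conic_between x z y"
proof -
  have eqs: "b *\<^sub>R y + a *\<^sub>R x + c *\<^sub>R z = 0" "c *\<^sub>R z + a *\<^sub>R x + b *\<^sub>R y = 0"
    using eq by (simp_all add: add_ac)
  have neg: "(- a) *\<^sub>R x + (- b) *\<^sub>R y + (- c) *\<^sub>R z = 0"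
    using arg_cong[OF eq, of uminus] by simp
  have negs: "(- b) *\<^sub>R y + (- a) *\<^sub>R x + (- c) *\<^sub>R z = 0" "(- c) *\<^sub>R z + (- a) *\<^sub>R x + (- b) *\<^sub>R y = 0"
    using arg_cong[OF eqs(1), of uminus] arg_cong[OF eqs(2), of uminus] by simp_all
  have p: "\<not> (0 \<le> a \<and> 0 \<le> b \<and> 0 \<le> c)" using K_nonneg_comb[OF K eq] nz by blast
  have m: "\<not> (a \<le> 0 \<and> b \<le> 0 \<and> c \<le> 0)" using K_nonneg_comb[OF K neg] nz by auto
  consider "a < 0" "0 \<le> b" "0 \<le> c" | "b < 0" "0 \<le> a" "0 \<le> c" | "c < 0" "0 \<le> a" "0 \<le> b"
    | "0 < a" "b \<le> 0" "c \<le> 0" | "0 < b" "a \<le> 0" "c \<le> 0" | "0 < c" "a \<le> 0" "b \<le> 0"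
    using p m by linarith
  then show ?thesis
  proof cases
    case 1 then show ?thesis using dependent_imp_between_aux[OF eq] by simp
  next
    case 2 then show ?thesis using dependent_imp_between_aux[OF eqs(1)] by simp
  next
    case 3 then show ?thesis using dependent_imp_between_aux[OF eqs(2)] by simp
  next
    case 4 then show ?thesis using dependent_imp_between_aux[OF neg] by simp
  next
    case 5 then show ?thesis using dependent_imp_between_aux[OF negs(1)] by simp
  next
    case 6 then show ?thesis using dependent_imp_between_aux[OF negs(2)] by simp
  qed
qed

lemma rdet_cocycle_frame:
  assumes F: "frame e f" and K: "x \<in> K" "y \<in> K" "z \<in> K"
    and c: "x = x1 *\<^sub>R e + x2 *\<^sub>R f" "y = y1 *\<^sub>R e + y2 *\<^sub>R f" "z = z1 *\<^sub>R e + z2 *\<^sub>R f"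
  shows "rdet x z = rdet x y * rdet y z"
proof -
  have p: "0 < x1" "0 < x2" "0 < y1" "0 < y2" using frame_K[OF F] K c by auto
  show ?thesis unfolding c rdet_frame[OF F p(1,2)] rdet_frame[OF F p(3,4)] using p by simp
qed

text \<open>
  In a common frame the cocycle identity is a cancellation of fractions.
\<close>

lemma rdet_cocycle_coplanar:
  assumes K: "x \<in> K" "y \<in> K" "z \<in> K"
    and b: "conic_between y x z \<or> conic_between x y z \<or> conic_between x z y"
  shows "rdet x z = rdet x y * rdet y z"
  using b
proof (elim disjE)
  assume "conic_between y x z"
  then obtain \<alpha> \<beta> where *: "x = \<alpha> *\<^sub>R y + \<beta> *\<^sub>R z" by (auto simp: conic_between_def)
  obtain e f y1 y2 z1 z2 where F: "frame e f" and y: "y = y1 *\<^sub>R e + y2 *\<^sub>R f" and z: "z = z1 *\<^sub>R e + z2 *\<^sub>R f"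
    using frame_exists[OF K(2), of z] by metis
  have "x = (\<alpha> * y1 + \<beta> * z1) *\<^sub>R e + (\<alpha> * y2 + \<beta> * z2) *\<^sub>R f" by (simp add: * y z algebra_simps)
  then show ?thesis using rdet_cocycle_frame[OF F K _ y z] by blast
next
  assume "conic_between x y z"
  then obtain \<alpha> \<beta> where *: "y = \<alpha> *\<^sub>R x + \<beta> *\<^sub>R z" by (auto simp: conic_between_def)
  obtain e f x1 x2 z1 z2 where F: "frame e f" and x: "x = x1 *\<^sub>R e + x2 *\<^sub>R f" and z: "z = z1 *\<^sub>R e + z2 *\<^sub>R f"
    using frame_exists[OF K(1), of z] by metis
  have "y = (\<alpha> * x1 + \<beta> * z1) *\<^sub>R e + (\<alpha> * x2 + \<beta> * z2) *\<^sub>R f" by (simp add: * x z algebra_simps)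
  then show ?thesis using rdet_cocycle_frame[OF F K x _ z] by blast
next
  assume "conic_between x z y"
  then obtain \<alpha> \<beta> where *: "z = \<alpha> *\<^sub>R x + \<beta> *\<^sub>R y" by (auto simp: conic_between_def)
  obtain e f x1 x2 y1 y2 where F: "frame e f" and x: "x = x1 *\<^sub>R e + x2 *\<^sub>R f" and y: "y = y1 *\<^sub>R e + y2 *\<^sub>R f"
    using frame_exists[OF K(1), of y] by metis
  have "z = (\<alpha> * x1 + \<beta> * y1) *\<^sub>R e + (\<alpha> * x2 + \<beta> * y2) *\<^sub>R f" by (simp add: * x y algebra_simps)
  then show ?thesis using rdet_cocycle_frame[OF F K x y] by blast
qed

end

section \<open>The cocycle identity of an order-antimorphism\<close>

text \<open>
  The maximum of the reciprocals is the reciprocal of the minimum.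
\<close>

lemma same_max_min:
  fixes a b c d :: real
  assumes "0 < a" "0 < b" "0 < c" "0 < d"
    and "max a b = max c d" "max (1 / a) (1 / b) = max (1 / c) (1 / d)"
  shows "(a = c \<and> b = d) \<or> (a = d \<and> b = c)"
  using assms by (auto simp: max_def field_simps split: if_splits)

locale antimorphism = strict_ou_space +
  fixes g :: "'a \<Rightarrow> 'a"
  assumes g_K: "x \<in> K \<Longrightarrow> g x \<in> K"
    and g_anti: "x \<in> K \<Longrightarrow> y \<in> K \<Longrightarrow> y - x \<in> C \<longleftrightarrow> g x - g y \<in> C"
    and g_scale: "x \<in> K \<Longrightarrow> 0 < c \<Longrightarrow> g (c *\<^sub>R x) = (1 / c) *\<^sub>R g x"
begin

lemma up_g:
  assumes K: "x \<in> K" "y \<in> K"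
  shows "up (g x) (g y) = up y x"
proof -
  have "up (g x) (g y) \<le> \<beta> \<longleftrightarrow> up y x \<le> \<beta>" if "0 < \<beta>" for \<beta>
  proof -
    have "up y x \<le> \<beta> \<longleftrightarrow> g x - g (\<beta> *\<^sub>R y) \<in> C"
      using up_le_iff[OF K(2)] g_anti[OF K(1) K_scale[OF K(2) that]] by simp
    also have "\<dots> \<longleftrightarrow> \<beta> *\<^sub>R (g x - g (\<beta> *\<^sub>R y)) \<in> C" using C_scale_iff that by simp
    also have "\<beta> *\<^sub>R (g x - g (\<beta> *\<^sub>R y)) = \<beta> *\<^sub>R g x - g y"
      using g_scale[OF K(2) that] that by (simp add: scaleR_diff_right)
    finally show ?thesis using up_le_iff[OF g_K[OF K(1)]] by simp
  qed
  from this[of "up y x"] this[of "up (g x) (g y)"] show ?thesis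
    using up_pos K g_K by force
qed

text \<open>
  Being conically between is the equality case of a triangle inequality for \<open>up\<close>, which \<open>g\<close> reverses.
\<close>

lemma g_between:
  assumes K: "x \<in> K" "y \<in> K" "z \<in> K" and b: "conic_between x z y"
  shows "conic_between (g x) (g z) (g y)"
proof -
  have "up (g x) (g y) = up (g z) (g y) * up (g x) (g z)"
    using conic_between_imp_geodesic[OF K b]
    by (simp add: up_g K mult.commute)
  then have "conic_between (g y) (g z) (g x)"
    using geodesic_imp_conic_between g_K K by blast
  then show ?thesis using conic_between_commute by blast
qed

text \<open>
  On a plane, \<open>g\<close> is a linear map divided by the product of the coordinates. Indeed, \<open>up_g\<close> for a pair
  of points determines the unordered pair of coordinate ratios of the images, which are the inverses
  of those of the points, possibly crossed. Ordering the image frame makes the pair \<open>x, y\<close> straight, and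
  then the third point is straight as well. The products of the corresponding coordinates of a point
  and its image are therefore constant on the plane, and multiplication by \<open>z\<^sub>1 z\<^sub>2\<close> makes \<open>g\<close> linear.
\<close>

lemma g_plane:
  assumes K: "x \<in> K" "y \<in> K" and st: "0 \<le> s" "0 \<le> t" and z: "z = s *\<^sub>R x + t *\<^sub>R y" and zK: "z \<in> K"
  shows "rdet x z *\<^sub>R g z = s *\<^sub>R g x + (t * rdet x y) *\<^sub>R g y"
proof -
  obtain e f x1 x2 y1 y2 where F: "frame e f" and x: "x = x1 *\<^sub>R e + x2 *\<^sub>R f" and y: "y = y1 *\<^sub>R e + y2 *\<^sub>R f"
    and xp: "0 < x1" "0 < x2" using frame_exists[OF K(1)] by metis
  have yp: "0 < y1" "0 < y2" using frame_K[OF F] K y by auto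
  define z1 z2 where z12: "z1 = s * x1 + t * y1" "z2 = s * x2 + t * y2"
  have z': "z = z1 *\<^sub>R e + z2 *\<^sub>R f" by (simp add: z x y z12 algebra_simps)
  have zp: "0 < z1" "0 < z2" using frame_K[OF F] zK z' by auto
  have "conic_between x z y" using st z by (auto simp: conic_between_def)
  then obtain \<alpha> \<beta> where gz: "g z = \<alpha> *\<^sub>R g x + \<beta> *\<^sub>R g y"
    using g_between[OF K zK] by (auto simp: conic_between_def)
  have pair: "a1 * A1 = b1 * B1 \<and> a2 * A2 = b2 * B2 \<or> a1 * A2 = b1 * B2 \<and> a2 * A1 = b2 * B1"
    if "frame e' f'" "v \<in> K" "w \<in> K" "v = a1 *\<^sub>R e + a2 *\<^sub>R f" "w = b1 *\<^sub>R e + b2 *\<^sub>R f"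
      "g v = A1 *\<^sub>R e' + A2 *\<^sub>R f'" "g w = B1 *\<^sub>R e' + B2 *\<^sub>R f'"
    for e' f' v w a1 a2 b1 b2 A1 A2 B1 B2
  proof -
    have pos: "0 < a1" "0 < a2" "0 < b1" "0 < b2" "0 < A1" "0 < A2" "0 < B1" "0 < B2"
      using frame_K[OF F] frame_K[OF that(1)] g_K that by metis+
    have "max (a1 / b1) (a2 / b2) = max (B1 / A1) (B2 / A2)"
      using up_g[OF that(2,3)] up_frame[OF F pos(3,4), of a1 a2] up_frame[OF that(1) pos(5,6), of B1 B2] that by simp
    moreover have "max (1 / (a1 / b1)) (1 / (a2 / b2)) = max (1 / (B1 / A1)) (1 / (B2 / A2))"
      using up_g[OF that(3,2)] up_frame[OF F pos(1,2), of b1 b2] up_frame[OF that(1) pos(7,8), of A1 A2] that by simp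
    ultimately have "a1 / b1 = B1 / A1 \<and> a2 / b2 = B2 / A2 \<or> a1 / b1 = B2 / A2 \<and> a2 / b2 = B1 / A1"
      using pos by (intro same_max_min) auto
    then show ?thesis using pos by (auto simp: field_simps)
  qed
  obtain e' f' X1 X2 Y1 Y2 where F': "frame e' f'" and gx: "g x = X1 *\<^sub>R e' + X2 *\<^sub>R f'"
    and gy: "g y = Y1 *\<^sub>R e' + Y2 *\<^sub>R f'" and straight: "x1 * X1 = y1 * Y1" "x2 * X2 = y2 * Y2"
  proof -
    obtain e' f' X1 X2 Y1 Y2 where F': "frame e' f'" and gx: "g x = X1 *\<^sub>R e' + X2 *\<^sub>R f'"
      and gy: "g y = Y1 *\<^sub>R e' + Y2 *\<^sub>R f'"
      using frame_exists[OF g_K[OF K(1)], of "g y"] by metis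
    from pair[OF F' K x y gx gy] show thesis
    proof
      assume "x1 * X1 = y1 * Y1 \<and> x2 * X2 = y2 * Y2"
      then show thesis using that F' gx gy by blast
    next
      assume "x1 * X2 = y1 * Y2 \<and> x2 * X1 = y2 * Y1"
      then show thesis using that[OF frame_swap[OF F'], of X2 X1 Y2 Y1] gx gy by (simp add: add.commute)
    qed
  qed
  define Z1 Z2 where Z12: "Z1 = \<alpha> * X1 + \<beta> * Y1" "Z2 = \<alpha> * X2 + \<beta> * Y2"
  have gz': "g z = Z1 *\<^sub>R e' + Z2 *\<^sub>R f'" by (simp add: gz gx gy Z12 algebra_simps)
  have Xp: "0 < X1" "0 < X2" "0 < Y1" "0 < Y2" using frame_K[OF F'] g_K K gx gy by metis+
  have Zx: "x1 * X1 = z1 * Z1 \<and> x2 * X2 = z2 * Z2"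
    using pair[OF F' K(1) zK x z' gx gz']
  proof
    assume cx: "x1 * X2 = z1 * Z2 \<and> x2 * X1 = z2 * Z1"
    show ?thesis
      using pair[OF F' K(2) zK y z' gy gz']
    proof
      assume cy: "y1 * Y2 = z1 * Z2 \<and> y2 * Y1 = z2 * Z1"
      \<comment> \<open>Crossed for both pairs: then all three points are proportional, and crossed and straight agree.\<close>
      have "(x1 * y2) * (X2 * Y2) = (x1 * X2) * (y2 * Y2)" by simp
      also have "\<dots> = (y1 * Y2) * (x2 * X2)" using cx cy straight by simp
      finally have "(x1 * y2) * (X2 * Y2) = (x2 * y1) * (X2 * Y2)" by (simp add: mult_ac)
      then have xy: "x1 * y2 = x2 * y1" using Xp by simp
      have zx: "z1 * x2 = z2 * x1" unfolding z12 using xy by algebra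
      have "(z2 * Z2) * x1 = (z1 * Z2) * x2" using zx by algebra
      also have "\<dots> = (x2 * X2) * x1" using cx by algebra
      finally have 1: "z2 * Z2 = x2 * X2" using xp by simp
      have "(z1 * Z1) * x2 = (z2 * Z1) * x1" using zx by algebra
      also have "\<dots> = (x1 * X1) * x2" using cx by algebra
      finally have "z1 * Z1 = x1 * X1" using xp by simp
      with 1 show ?thesis by simp
    qed (use straight in simp)
  qed simp
  have rz: "rdet x z = z1 * z2 / (x1 * x2)" unfolding x z' by (rule rdet_frame[OF F xp])
  have ry: "rdet x y = y1 * y2 / (x1 * x2)" unfolding x y by (rule rdet_frame[OF F xp])
  have "z1 * z2 * Z1 = s * (x1 * x2) * X1 + t * (y1 * y2) * Y1"
    using Zx straight unfolding z12 by algebra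
  then have c1: "rdet x z * Z1 = s * X1 + t * rdet x y * Y1" unfolding rz ry using xp by (simp add: field_simps)
  have "z1 * z2 * Z2 = s * (x1 * x2) * X2 + t * (y1 * y2) * Y2"
    using Zx straight unfolding z12 by algebra
  then have c2: "rdet x z * Z2 = s * X2 + t * rdet x y * Y2" unfolding rz ry using xp by (simp add: field_simps)
  have "rdet x z *\<^sub>R g z = (rdet x z * Z1) *\<^sub>R e' + (rdet x z * Z2) *\<^sub>R f'" by (simp add: gz' scaleR_add_right)
  also have "\<dots> = s *\<^sub>R g x + (t * rdet x y) *\<^sub>R g y" unfolding c1 c2 gx gy by (simp add: algebra_simps)
  finally show ?thesis .
qed

text \<open>
  In the projective picture, the line from \<open>z\<close> through \<open>x + y + z\<close> meets the line through \<open>x\<close> and \<open>y\<close> in \<open>x + y\<close>. Mapped by \<open>g\<close>, this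
  shows that the ratio of the coefficients of \<open>g x\<close> and \<open>g y\<close> in \<open>g (x + y + z)\<close> is \<open>rdet x y\<close>.
\<close>

lemma g_ceva:
  assumes K: "x \<in> K" "y \<in> K" "z \<in> K"
  shows "\<exists>k>0. \<exists>l. k *\<^sub>R g (x + y + z) = g x + rdet x y *\<^sub>R g y + l *\<^sub>R g z"
proof -
  have xy: "x + y \<in> K" "x + y + z \<in> K" using K K_add by auto
  have 1: "rdet x (x + y) *\<^sub>R g (x + y) = g x + rdet x y *\<^sub>R g y"
    using g_plane[of x y 1 1] K xy by simp
  have 2: "rdet (x + y) (x + y + z) *\<^sub>R g (x + y + z) = g (x + y) + rdet (x + y) z *\<^sub>R g z"
    using g_plane[of "x + y" z 1 1] K xy by simp
  have "(rdet x (x + y) * rdet (x + y) (x + y + z)) *\<^sub>R g (x + y + z) = g x + rdet x y *\<^sub>R g y + (rdet x (x + y) * rdet (x + y) z) *\<^sub>R g z"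
    using arg_cong[OF 2, of "\<lambda>v. rdet x (x + y) *\<^sub>R v"] 1 by (simp add: scaleR_add_right)
  moreover have "0 < rdet x (x + y) * rdet (x + y) (x + y + z)" using rdet_pos K xy by simp
  ultimately show ?thesis by blast
qed

end

locale bij_antimorphism = antimorphism +
  assumes g_bij: "bij_betw g K K"
begin

text \<open>
  The inverse of \<open>g\<close> on \<open>K\<close> is an antihomogeneous order-antimorphism too, so betweenness is also
  reflected. This transfers linear independence from \<open>x, y, z\<close> to their images.
\<close>

lemma between_g_iff:
  assumes K: "x \<in> K" "y \<in> K" "z \<in> K"
  shows "conic_between (g x) (g z) (g y) \<longleftrightarrow> conic_between x z y"
proof
  define h where "h = inv_into K g"
  have gh: "g (h v) = v" "h v \<in> K" if "v \<in> K" for v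
    using that g_bij bij_betw_inv_into_right bij_betw_inv_into bij_betwE unfolding h_def by fast+
  have hg: "h (g v) = v" if "v \<in> K" for v
    using that g_bij bij_betw_inv_into_left unfolding h_def by fast
  interpret h: antimorphism C u h
  proof
    fix x y and c :: real assume x: "x \<in> K"
    show "h x \<in> K" using gh x by simp
    show "(y - x \<in> C) = (h x - h y \<in> C)" if "y \<in> K"
      using g_anti[of "h y" "h x"] gh x that by simp
    show "h (c *\<^sub>R x) = (1 / c) *\<^sub>R h x" if c: "0 < c"
    proof -
      have "g ((1 / c) *\<^sub>R h x) = c *\<^sub>R x" using g_scale[of "h x" "1 / c"] gh x c by simp
      moreover have "(1 / c) *\<^sub>R h x \<in> K" using gh x c K_scale by simp
      ultimately show ?thesis using hg by metis
    qed
  qed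
  assume "conic_between (g x) (g z) (g y)"
  then show "conic_between x z y" using h.g_between[of "g x" "g y" "g z"] hg g_K K by simp
qed (use g_between K in blast)

text \<open>
  For independent images, the coefficients of \<open>g (x + y + z)\<close> are unique up to a common factor. By
  \<open>g_ceva\<close> their ratios are the three relative determinants, so these multiply as in Ceva's theorem.
\<close>

lemma rdet_cocycle:
  assumes K: "x \<in> K" "y \<in> K" "z \<in> K"
  shows "rdet x z = rdet x y * rdet y z"
proof (cases "conic_between y x z \<or> conic_between x y z \<or> conic_between x z y")
  case True
  then show ?thesis using rdet_cocycle_coplanar K by blast
next
  case False
  have gK: "g x \<in> K" "g y \<in> K" "g z \<in> K" using g_K K by auto
  have indep: "a = 0 \<and> b = 0 \<and> c = 0" if "a *\<^sub>R g x + b *\<^sub>R g y + c *\<^sub>R g z = 0" for a b c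
    using dependent_imp_between[OF gK that] False between_g_iff K by blast
  obtain k l where 1: "0 < k" "k *\<^sub>R g (x + y + z) = g x + rdet x y *\<^sub>R g y + l *\<^sub>R g z"
    using g_ceva[OF K] by blast
  obtain k' l' where 2: "0 < k'" "k' *\<^sub>R g (x + y + z) = g y + rdet y z *\<^sub>R g z + l' *\<^sub>R g x"
    using g_ceva[OF K(2,3,1)] by (auto simp: add_ac)
  obtain k'' l'' where 3: "0 < k''" "k'' *\<^sub>R g (x + y + z) = g x + rdet x z *\<^sub>R g z + l'' *\<^sub>R g y"
    using g_ceva[OF K(1,3,2)] by (auto simp: add_ac)
  have "k'' *\<^sub>R (k *\<^sub>R g (x + y + z)) - k *\<^sub>R (k'' *\<^sub>R g (x + y + z)) = 0" by simp
  then have "(k'' - k) *\<^sub>R g x + (k'' * rdet x y - k * l'') *\<^sub>R g y + (k'' * l - k * rdet x z) *\<^sub>R g z = 0"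
    unfolding 1(2) 3(2) by (simp add: algebra_simps)
  from indep[OF this] have e1: "l = rdet x z" using 1 3 by auto
  have "k' *\<^sub>R (k *\<^sub>R g (x + y + z)) - k *\<^sub>R (k' *\<^sub>R g (x + y + z)) = 0" by simp
  then have "(k' - k * l') *\<^sub>R g x + (k' * rdet x y - k) *\<^sub>R g y + (k' * l - k * rdet y z) *\<^sub>R g z = 0"
    unfolding 1(2) 2(2) by (simp add: algebra_simps)
  from indep[OF this] have "k = k' * rdet x y" "k' * l = k * rdet y z" by auto
  then show ?thesis using e1 2(1) by simp
qed

end

section \<open>From the cocycle identity to a spin factor\<close>

locale cocycle_ou_space = strict_ou_space +
  assumes cocycle: "x \<in> K \<Longrightarrow> y \<in> K \<Longrightarrow> z \<in> K \<Longrightarrow> rdet x z = rdet x y * rdet y z"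
begin

definition B :: "'a \<Rightarrow> 'a \<Rightarrow> real" where "B v w = (Q (v + w) - Q v - Q w) / 2"

lemma B_u: "B v u = trc v"
  using Q_shift[of v 1] Q_shift[of 0 1] by (simp add: B_def trc_zero Q_zero)

lemma B_commute: "B v w = B w v"
  by (simp add: B_def add.commute)

text \<open>
  By the cocycle identity \<open>Q = Q x * rdet x\<close> on \<open>K\<close>, and \<open>rdet x\<close> is a product of coordinates in the plane
  of \<open>x\<close> and \<open>y\<close>.
\<close>

lemma Q_plane:
  assumes K: "x \<in> K" "y \<in> K" and st: "0 < s" "0 < t"
  shows "Q (s *\<^sub>R x + t *\<^sub>R y) = s\<^sup>2 * Q x + 2 * s * t * B x y + t\<^sup>2 * Q y"
proof -
  obtain e f x1 x2 y1 y2 where F: "frame e f" and x: "x = x1 *\<^sub>R e + x2 *\<^sub>R f" and y: "y = y1 *\<^sub>R e + y2 *\<^sub>R f"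
    and xp: "0 < x1" "0 < x2" using frame_exists[OF K(1)] by metis
  have *: "Q (s *\<^sub>R x + t *\<^sub>R y) = Q x * ((s * x1 + t * y1) * (s * x2 + t * y2) / (x1 * x2))"
    if "0 \<le> s" "0 \<le> t" "s *\<^sub>R x + t *\<^sub>R y \<in> K" for s t
  proof -
    have "s *\<^sub>R x + t *\<^sub>R y = (s * x1 + t * y1) *\<^sub>R e + (s * x2 + t * y2) *\<^sub>R f"
      by (simp add: x y algebra_simps)
    then have "rdet x (s *\<^sub>R x + t *\<^sub>R y) = (s * x1 + t * y1) * (s * x2 + t * y2) / (x1 * x2)"
      using rdet_frame[OF F xp] x by simp
    then show ?thesis using cocycle[OF u_in_K K(1) that(3)] by simp
  qed
  have "s *\<^sub>R x + t *\<^sub>R y \<in> K" "x + y \<in> K" using K st K_add K_scale by auto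
  then have 1: "Q (s *\<^sub>R x + t *\<^sub>R y) = Q x * ((s * x1 + t * y1) * (s * x2 + t * y2) / (x1 * x2))"
    and 2: "Q (x + y) = Q x * ((x1 + y1) * (x2 + y2) / (x1 * x2))"
    and 3: "Q y = Q x * ((y1) * (y2) / (x1 * x2))"
    using *[of s t] *[of 1 1] *[of 0 1] st K by auto
  show ?thesis unfolding B_def 1 2 3 using xp by (simp add: field_simps power2_eq_square)
qed

text \<open>
  Expand \<open>Q (x + s y + z)\<close> along \<open>y\<close> starting at \<open>x + z\<close>, and \<open>Q (x + s y)\<close> starting at \<open>x\<close>: the terms in \<open>s\<^sup>2\<close>
  cancel, so the dependence on \<open>s\<close> is affine.
\<close>

lemma B_K_line:
  assumes K: "x \<in> K" "y \<in> K" "z \<in> K" and s: "0 < s"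
  shows "B (x + s *\<^sub>R y) z = B x z + s * (B (x + z) y - B x y)"
proof -
  have "x + z \<in> K" using K K_add by auto
  then have "Q ((x + z) + s *\<^sub>R y) = Q (x + z) + 2 * s * B (x + z) y + s\<^sup>2 * Q y"
    using Q_plane[of "x + z" y 1 s] K s by simp
  moreover have "Q (x + s *\<^sub>R y) = Q x + 2 * s * B x y + s\<^sup>2 * Q y"
    using Q_plane[of x y 1 s] K s by simp
  moreover have "B (x + s *\<^sub>R y) z = (Q ((x + z) + s *\<^sub>R y) - Q (x + s *\<^sub>R y) - Q z) / 2"
    by (simp add: B_def add_ac)
  ultimately show ?thesis using B_def[of x z] by (simp add: field_simps)
qed

lemma B_K_scale:
  assumes K: "x \<in> K" "y \<in> K" and s: "0 < s"
  shows "B (s *\<^sub>R x) y = s * B x y"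
  using Q_plane[OF K s, of 1] by (simp add: B_def[of "s *\<^sub>R x" y] Q_scale_pos s)

text \<open>
  The affine function of \<open>s\<close> in \<open>B_K_line\<close> can be computed from either end: \<open>B (y + t x) z\<close> equals
  \<open>t B (x + y / t) z\<close>, and comparing the constant terms in \<open>t\<close> identifies the slope as \<open>B y z\<close>.
\<close>

lemma B_K_add:
  assumes K: "x \<in> K" "y \<in> K" "z \<in> K"
  shows "B (x + y) z = B x z + B y z"
proof -
  define \<kappa> \<kappa>' where "\<kappa> = B (x + z) y - B x y" and "\<kappa>' = B (y + z) x - B y x"
  have "B y z + t * \<kappa>' = t * B x z + \<kappa>" if t: "0 < t" for t
  proof -
    have "y + t *\<^sub>R x = t *\<^sub>R (x + (1 / t) *\<^sub>R y)" using t by (simp add: scaleR_add_right add.commute)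
    moreover have "x + (1 / t) *\<^sub>R y \<in> K" using K t K_add K_scale by simp
    ultimately have "B (y + t *\<^sub>R x) z = t * B (x + (1 / t) *\<^sub>R y) z" using B_K_scale K t by simp
    then show ?thesis
      using B_K_line[OF K(2,1,3) t] B_K_line[OF K, of "1 / t"] t
      by (simp add: \<kappa>_def \<kappa>'_def algebra_simps)
  qed
  from this[of 1] this[of 2] have "\<kappa> = B y z" by simp
  then show ?thesis using B_K_line[OF K, of 1] by (simp add: \<kappa>_def)
qed

lemma shift_into_K:
  obtains c where "x + c *\<^sub>R u \<in> K" "y + c *\<^sub>R u \<in> K" "z + c *\<^sub>R u \<in> K"
proof -
  define c where "c = 1 + \<bar>lo u x\<bar> + \<bar>lo u y\<bar> + \<bar>lo u z\<bar>"
  have "x + c *\<^sub>R u \<in> K" "y + c *\<^sub>R u \<in> K" "z + c *\<^sub>R u \<in> K"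
    unfolding in_K_iff_lo[OF u_in_K] lo_shift[OF u_in_K] c_def by linarith+
  then show thesis by (rule that)
qed

lemma trc_add: "trc (x + y) = trc x + trc y"
proof -
  obtain c where c: "x + c *\<^sub>R u \<in> K" "y + c *\<^sub>R u \<in> K" using shift_into_K by metis
  have eq: "(x + c *\<^sub>R u) + (y + c *\<^sub>R u) = (x + y) + (2 * c) *\<^sub>R u"
    by (simp add: algebra_simps flip: scaleR_left_distrib)
  have "trc ((x + c *\<^sub>R u) + (y + c *\<^sub>R u)) = trc (x + c *\<^sub>R u) + trc (y + c *\<^sub>R u)"
    using B_K_add[OF c u_in_K] by (simp only: B_u)
  then show ?thesis unfolding eq trc_shift by simp
qed

lemma B_shift: "B (v + c *\<^sub>R u) (w + d *\<^sub>R u) = B v w + c * trc w + d * trc v + c * d"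
proof -
  have eq: "(v + c *\<^sub>R u) + (w + d *\<^sub>R u) = (v + w) + (c + d) *\<^sub>R u" by (simp add: algebra_simps)
  show ?thesis unfolding B_def eq Q_shift trc_add by (simp add: field_simps power2_eq_square)
qed

lemma B_add: "B (x + y) z = B x z + B y z"
proof -
  obtain c where c: "x + c *\<^sub>R u \<in> K" "y + c *\<^sub>R u \<in> K" "z + c *\<^sub>R u \<in> K" using shift_into_K by metis
  have eq: "(x + c *\<^sub>R u) + (y + c *\<^sub>R u) = (x + y) + (2 * c) *\<^sub>R u"
    by (simp add: algebra_simps flip: scaleR_left_distrib)
  have "B ((x + y) + (2 * c) *\<^sub>R u) (z + c *\<^sub>R u) = B (x + c *\<^sub>R u) (z + c *\<^sub>R u) + B (y + c *\<^sub>R u) (z + c *\<^sub>R u)"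
    using B_K_add[OF c] by (simp only: eq)
  then show ?thesis unfolding B_shift trc_add by (simp add: algebra_simps)
qed

lemma B_zero: "B 0 z = 0"
  by (simp add: B_def Q_zero)

lemma B_minus: "B (- x) z = - B x z"
  using B_add[of x "- x" z] by (simp add: B_zero)

lemma trc_scale: "trc (s *\<^sub>R x) = s * trc x"
proof -
  consider "s = 0" | "0 < s" | "0 < - s" by linarith
  then show ?thesis
  proof cases
    case 3
    then show ?thesis using trc_scale_pos[OF 3, of x] by (simp add: trc_minus)
  qed (simp_all add: trc_zero trc_scale_pos)
qed

lemma B_scale: "B (s *\<^sub>R x) z = s * B x z"
proof -
  have pos: "B (s *\<^sub>R x) z = s * B x z" if s: "0 < s" for s
  proof -
    obtain c where c: "x + c *\<^sub>R u \<in> K" "z + c *\<^sub>R u \<in> K" using shift_into_K by metis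
    have "s *\<^sub>R (x + c *\<^sub>R u) = s *\<^sub>R x + (s * c) *\<^sub>R u" by (simp add: scaleR_add_right)
    then have "B (s *\<^sub>R x + (s * c) *\<^sub>R u) (z + c *\<^sub>R u) = s * B (x + c *\<^sub>R u) (z + c *\<^sub>R u)"
      using B_K_scale[OF c s] by simp
    then show ?thesis unfolding B_shift trc_scale by (simp add: algebra_simps)
  qed
  consider "s = 0" | "0 < s" | "0 < - s" by linarith
  then show ?thesis
  proof cases
    case 3
    then show ?thesis using pos[OF 3] by (simp add: B_minus)
  qed (simp_all add: B_zero pos)
qed

lemma B_scale_right: "B x (s *\<^sub>R z) = s * B x z"
  using B_scale[of s z x] by (simp only: B_commute[of x])

lemma B_self: "B x x = Q x"
proof -
  have "x + x = 2 *\<^sub>R x" by (simp add: scaleR_2)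
  then show ?thesis by (simp add: B_def Q_scale_pos)
qed

definition H :: "'a set" where "H = {v. trc v = 0}"

text \<open>
  The value \<open>0\<close> outside \<open>H\<close> keeps \<open>ip x x\<close> nonnegative for all vectors, so that its square root is a
  metric in the sense of the locale \<open>Metric_space\<close>, whose nonnegativity axiom is not relative to \<open>H\<close>.
\<close>

definition ip :: "'a \<Rightarrow> 'a \<Rightarrow> real" where "ip x y = (if x \<in> H \<and> y \<in> H then - B x y else 0)"

lemma subspace_H: "subspace H"
  by (simp add: subspace_def H_def trc_zero trc_add trc_scale)

lemma H_lo: "h \<in> H \<Longrightarrow> lo u h = - up u h"
  by (simp add: H_def trc_def)

lemma H_up_nonneg: "h \<in> H \<Longrightarrow> 0 \<le> up u h"
  using lo_le_up[OF u_in_K, of h] H_lo[of h] by simp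

lemma H_ip: "h \<in> H \<Longrightarrow> ip h h = (up u h)\<^sup>2"
  by (simp add: ip_def B_self rdet_def H_lo power2_eq_square)

lemma H_sqrt_ip: "h \<in> H \<Longrightarrow> sqrt (ip h h) = up u h"
  by (simp add: H_ip H_up_nonneg)

lemma ou_norm_spin:
  assumes "h \<in> H"
  shows "ou_norm C u (h + \<mu> *\<^sub>R u) = sqrt (ip h h) + \<bar>\<mu>\<bar>"
proof -
  have "up u (- (h + \<mu> *\<^sub>R u)) = up u h - \<mu>"
    using assms by (simp only: up_minus lo_shift[OF u_in_K] H_lo)
  then show ?thesis
    unfolding ou_norm_eq H_sqrt_ip[OF assms] up_shift[OF u_in_K] by (simp add: max_def)
qed

lemma ou_norm_H: "h \<in> H \<Longrightarrow> ou_norm C u h = sqrt (ip h h)"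
  using ou_norm_spin[of h 0] by simp

lemma abs_trc_le: "\<bar>trc v\<bar> \<le> ou_norm C u v"
proof -
  have "max a (- b) \<ge> \<bar>(a + b) / 2\<bar>" if "b \<le> a" for a b :: real
    using that by (auto simp: max_def abs_if field_simps)
  from this[OF lo_le_up[OF u_in_K, of v]] show ?thesis
    by (simp add: trc_def ou_norm_eq up_minus)
qed

lemma inner_product_H: "inner_product_on H ip"
  unfolding inner_product_on_def
proof (intro conjI ballI allI)
  fix x y assume "x \<in> H" "y \<in> H"
  show "ip x y = ip y x" by (auto simp: ip_def B_commute)
next
  fix x assume x: "x \<in> H"
  show "0 \<le> ip x x" by (simp add: H_ip x)
  show "ip x x = 0 \<longleftrightarrow> x = 0"
  proof
    assume "ip x x = 0"
    then have "ou_norm C u x = 0" using ou_norm_H x by simp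
    then show "x = 0" using ou_norm_zero_iff by simp
  qed (simp add: ip_def B_zero)
qed (simp_all add: ip_def B_add B_scale subspace_add[OF subspace_H] subspace_scale[OF subspace_H])

text \<open>
  On \<open>H\<close> the Hilbert metric is the restriction of the order unit metric, and \<open>H\<close> is closed as the kernel
  of \<open>trc\<close>, which is bounded by the order unit norm.
\<close>

lemma complete_H:
  assumes comp: "ou_complete C u"
  shows "Metric_space.mcomplete H (\<lambda>x y. sqrt (ip (x - y) (x - y)))"
proof -
  let ?d = "\<lambda>x y. sqrt (ip (x - y) (x - y))"
  have d: "?d x y = ou_dist C u x y" if "x \<in> H" "y \<in> H" for x y
    using ou_norm_H[OF subspace_diff[OF subspace_H that]] by (simp add: ou_dist_def)
  have d_sym: "?d x y = ?d y x" for x y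
  proof -
    have "x - y = - (y - x)" by simp
    then have "x - y \<in> H \<longleftrightarrow> y - x \<in> H" "Q (x - y) = Q (y - x)"
      using subspace_neg[OF subspace_H, of "x - y"] subspace_neg[OF subspace_H, of "y - x"] Q_minus[of "y - x"]
      by auto
    then show ?thesis by (simp add: ip_def B_self)
  qed
  interpret H: Metric_space H "?d"
  proof
    fix x y
    show "?d x y = ?d y x" by (rule d_sym)
    show "0 \<le> ?d x y"
      using H_ip[of "x - y"] by (cases "x - y \<in> H") (simp_all add: ip_def)
  next
    fix x y assume "x \<in> H" "y \<in> H"
    then show "?d x y = 0 \<longleftrightarrow> x = y" by (simp only: d ouM.zero UNIV_I)
  next
    fix x y z assume "x \<in> H" "y \<in> H" "z \<in> H"
    then show "?d x z \<le> ?d x y + ?d y z" by (simp only: d ouM.triangle UNIV_I)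
  qed
  show ?thesis
    unfolding H.mcomplete_def
  proof (intro allI impI)
    fix \<sigma> assume \<sigma>: "H.MCauchy \<sigma>"
    then have \<sigma>H: "\<sigma> n \<in> H" for n by (auto simp: H.MCauchy_def)
    have "ouM.MCauchy \<sigma>" using \<sigma> unfolding H.MCauchy_def ouM.MCauchy_def by (simp only: d \<sigma>H subset_UNIV simp_thms) blast
    then obtain l where l: "limitin ouM.mtopology \<sigma> l sequentially"
      using comp unfolding ou_complete_def ouM.mcomplete_def by blast
    have lim: "\<forall>\<^sub>F n in sequentially. ou_dist C u (\<sigma> n) l < \<epsilon>" if "0 < \<epsilon>" for \<epsilon>
      using l that by (auto simp: ouM.limitin_metric)
    have "\<bar>trc l\<bar> \<le> 0"
    proof (rule field_le_epsilon)
      fix \<epsilon> :: real assume "0 < \<epsilon>"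
      then obtain n where n: "ou_dist C u (\<sigma> n) l < \<epsilon>" using eventually_happens'[OF _ lim] sequentially_bot by blast
      have "trc l = - trc (\<sigma> n - l)"
        using trc_add[of "\<sigma> n - l" l] \<sigma>H[of n] by (simp add: H_def)
      then show "\<bar>trc l\<bar> \<le> 0 + \<epsilon>" using n abs_trc_le[of "\<sigma> n - l"] by (simp add: ou_dist_def)
    qed
    then have "l \<in> H" by (simp add: H_def)
    moreover have "\<forall>\<^sub>F n in sequentially. \<sigma> n \<in> H \<and> ?d (\<sigma> n) l < \<epsilon>" if "0 < \<epsilon>" for \<epsilon>
      using lim[OF that] by eventually_elim (simp only: \<sigma>H \<open>l \<in> H\<close> d simp_thms)
    ultimately show "\<exists>x. limitin H.mtopology \<sigma> x sequentially"
      unfolding H.limitin_metric by blast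
  qed
qed

lemma decomposition_H: "direct_sum_decomposition H (span {u})"
proof -
  have "H \<inter> span {u} = {0}"
    by (auto simp: H_def span_singleton trc_scale trc_u trc_zero)
  moreover have "\<exists>h k. v = h + k \<and> h \<in> H \<and> k \<in> span {u}" for v
  proof (intro exI conjI)
    show "v = (v - trc v *\<^sub>R u) + trc v *\<^sub>R u" by simp
    show "v - trc v *\<^sub>R u \<in> H" using trc_shift[of v "- trc v"] by (simp add: H_def)
    show "trc v *\<^sub>R u \<in> span {u}" by (simp add: span_base span_scale)
  qed
  ultimately show ?thesis
    unfolding direct_sum_decomposition_def using subspace_H subspace_span
    by (intro conjI set_eqI iffI UNIV_I CollectI) simp_all
qed

text \<open>
  The eigenvalues of the square of \<open>a + \<alpha> u\<close> are \<open>(\<alpha> + up u a)\<^sup>2\<close> and \<open>(\<alpha> - up u a)\<^sup>2\<close>, hence nonnegative.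
  Conversely, a vector with nonnegative eigenvalues has a square root whose eigenvalues are the
  square roots \<open>p\<close> and \<open>q\<close>.
\<close>

lemma squares_eq: "C = range (\<lambda>a. spin_product H ip u a a)"
proof (intro equalityI subsetI)
  fix v assume "v \<in> range (\<lambda>a. spin_product H ip u a a)"
  then obtain w where w: "v = spin_product H ip u w w" by blast
  define \<alpha> a where "\<alpha> = trc w" and "a = w - \<alpha> *\<^sub>R u"
  have a: "a \<in> H" "w = a + \<alpha> *\<^sub>R u"
    using trc_shift[of w "- \<alpha>"] by (simp_all add: H_def a_def \<alpha>_def)
  have v: "v = (2 * \<alpha>) *\<^sub>R a + (ip a a + \<alpha> * \<alpha>) *\<^sub>R u"
    unfolding w spin_product_eq[OF decomposition_H u_nz a(1) a(1), where \<alpha> = \<alpha> and \<beta> = \<alpha>, folded a(2)]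
    by (simp only: mult_2 scaleR_left_distrib)
  have aH: "(2 * \<alpha>) *\<^sub>R a \<in> H" using a subspace_H subspace_scale by blast
  have "up u ((2 * \<alpha>) *\<^sub>R a) = sqrt (ip ((2 * \<alpha>) *\<^sub>R a) ((2 * \<alpha>) *\<^sub>R a))" using H_sqrt_ip[OF aH] by simp
  also have "ip ((2 * \<alpha>) *\<^sub>R a) ((2 * \<alpha>) *\<^sub>R a) = (2 * \<alpha>)\<^sup>2 * ip a a"
    using a(1) aH by (simp add: ip_def B_scale B_scale_right power2_eq_square)
  also have "sqrt \<dots> = 2 * \<bar>\<alpha>\<bar> * up u a" by (simp add: real_sqrt_mult H_sqrt_ip a(1))
  finally have "lo u v = ((up u a)\<^sup>2 + \<alpha>\<^sup>2) - 2 * \<bar>\<alpha>\<bar> * up u a"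
    unfolding v lo_shift[OF u_in_K] H_lo[OF aH] H_ip[OF a(1)] by (simp add: power2_eq_square)
  also have "\<dots> = (up u a - \<bar>\<alpha>\<bar>)\<^sup>2" by (simp add: power2_eq_square algebra_simps)
  finally show "v \<in> C" unfolding in_C_iff_lo_u by simp
next
  fix v assume vC: "v \<in> C"
  define \<tau> h \<rho> where "\<tau> = trc v" and "h = v - \<tau> *\<^sub>R u" and "\<rho> = up u h"
  have v: "v = h + \<tau> *\<^sub>R u" by (simp add: h_def)
  have h: "h \<in> H" using trc_shift[of v "- \<tau>"] by (simp add: H_def h_def \<tau>_def)
  have \<rho>: "0 \<le> \<rho>" "\<rho> \<le> \<tau>"
  proof -
    show "0 \<le> \<rho>" using H_up_nonneg h by (simp add: \<rho>_def)
    have "lo u v = \<tau> - \<rho>" unfolding v lo_shift[OF u_in_K] H_lo[OF h] by (simp add: \<rho>_def)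
    then show "\<rho> \<le> \<tau>" using vC by (simp add: in_C_iff_lo_u)
  qed
  define p q where "p = sqrt (\<tau> + \<rho>)" and "q = sqrt (\<tau> - \<rho>)"
  have pq: "p\<^sup>2 = \<tau> + \<rho>" "q\<^sup>2 = \<tau> - \<rho>" "0 \<le> p" "0 \<le> q" using \<rho> by (auto simp: p_def q_def)
  define \<alpha> where "\<alpha> = (p + q) / 2"
  define a where "a = (1 / (2 * \<alpha>)) *\<^sub>R h"
  have aH: "a \<in> H" unfolding a_def using h subspace_H subspace_scale by blast
  have ipa: "ip a a = (1 / (2 * \<alpha>))\<^sup>2 * \<rho>\<^sup>2"
  proof -
    have "ip a a = (1 / (2 * \<alpha>))\<^sup>2 * ip h h"
      using h aH by (simp add: a_def ip_def B_scale B_scale_right power2_eq_square)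
    then show ?thesis using H_ip[OF h] by (simp add: \<rho>_def)
  qed
  have "(2 * \<alpha>) *\<^sub>R a = h \<and> ip a a + \<alpha> * \<alpha> = \<tau>"
  proof (cases "\<alpha> = 0")
    case True
    then have "p = 0" "q = 0" using pq by (auto simp: \<alpha>_def)
    then have z: "\<tau> = 0" "\<rho> = 0" using pq by auto
    then have "ou_norm C u h = 0" using ou_norm_H H_sqrt_ip h by (simp add: \<rho>_def)
    then show ?thesis using True z ipa ou_norm_zero_iff by simp
  next
    case False
    have "\<rho> = (p\<^sup>2 - q\<^sup>2) / 2" and \<tau>: "\<tau> = (p\<^sup>2 + q\<^sup>2) / 2" using pq by auto
    moreover have "(p\<^sup>2 - q\<^sup>2) / 2 = (2 * \<alpha>) * ((p - q) / 2)" by (simp add: \<alpha>_def power2_eq_square square_diff_square_factored)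
    ultimately have "\<rho> / (2 * \<alpha>) = (p - q) / 2" using False by simp
    then have "ip a a = ((p - q) / 2)\<^sup>2"
      unfolding ipa power_mult_distrib[symmetric] by (simp only: times_divide_eq_left mult_1)
    moreover have "((p - q) / 2)\<^sup>2 + ((p + q) / 2)\<^sup>2 = (p\<^sup>2 + q\<^sup>2) / 2"
      by (simp add: power_divide power2_sum power2_diff add_divide_distrib diff_divide_distrib)
    ultimately have "ip a a + \<alpha> * \<alpha> = \<tau>"
      unfolding \<tau> \<alpha>_def by (simp only: power2_eq_square)
    moreover have "(2 * \<alpha>) *\<^sub>R a = h" using False by (simp add: a_def)
    ultimately show ?thesis by simp
  qed
  then have "v = (2 * \<alpha>) *\<^sub>R a + (ip a a + \<alpha> * \<alpha>) *\<^sub>R u"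
    using v by (simp only:)
  then have "v = \<alpha> *\<^sub>R a + \<alpha> *\<^sub>R a + (ip a a + \<alpha> * \<alpha>) *\<^sub>R u"
    by (simp only: mult_2 scaleR_left_distrib)
  then have "v = spin_product H ip u (a + \<alpha> *\<^sub>R u) (a + \<alpha> *\<^sub>R u)"
    using spin_product_eq[OF decomposition_H u_nz aH aH] by simp
  then show "v \<in> range (\<lambda>a. spin_product H ip u a a)" by blast
qed

lemma spin_factor_if_complete: "ou_complete C u \<Longrightarrow> spin_factor C u"
  unfolding spin_factor_def hilbert_subspace_def
  by (intro conjI exI[of _ H] exI[of _ ip] ballI allI big u_nz subspace_H inner_product_H complete_H
      decomposition_H squares_eq ou_norm_spin)

end

section \<open>The Jordan inverse of a spin factor\<close>

locale spin_ou_space = ou_space +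
  fixes H :: "'a set" and ip :: "'a \<Rightarrow> 'a \<Rightarrow> real"
  assumes decomposition: "direct_sum_decomposition H (span {u})"
    and inner: "inner_product_on H ip"
    and ou_norm_eq_spin: "a \<in> H \<Longrightarrow> ou_norm C u (a + \<mu> *\<^sub>R u) = sqrt (ip a a) + \<bar>\<mu>\<bar>"
begin

lemma H_subspace: "subspace H"
  using decomposition by (simp add: direct_sum_decomposition_def)

lemma ip_commute: "x \<in> H \<Longrightarrow> y \<in> H \<Longrightarrow> ip x y = ip y x"
  and ip_add: "x \<in> H \<Longrightarrow> y \<in> H \<Longrightarrow> z \<in> H \<Longrightarrow> ip (x + y) z = ip x z + ip y z"
  and ip_scale: "x \<in> H \<Longrightarrow> y \<in> H \<Longrightarrow> ip (c *\<^sub>R x) y = c * ip x y"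
  and ip_nonneg: "x \<in> H \<Longrightarrow> 0 \<le> ip x x"
  and ip_zero_iff: "x \<in> H \<Longrightarrow> ip x x = 0 \<longleftrightarrow> x = 0"
  using inner by (simp_all add: inner_product_on_def)

lemma spin_coords: obtains a \<alpha> where "a \<in> H" "v = a + \<alpha> *\<^sub>R u"
proof -
  have "v \<in> {h + k | h k. h \<in> H \<and> k \<in> span {u}}"
    using decomposition unfolding direct_sum_decomposition_def by blast
  then obtain a k where "a \<in> H" "k \<in> span {u}" "v = a + k" by blast
  then show thesis using that unfolding span_singleton by blast
qed

text \<open>
  Far out along \<open>u\<close> the order unit norm is attained on the upper side, where it equals
  \<open>up u a + \<mu>\<close>; so the norm formula determines the eigenvalues and with them the cone.
\<close>

lemma up_H:
  assumes "a \<in> H" shows "up u a = sqrt (ip a a)"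
proof -
  define \<mu> where "\<mu> = \<bar>up u a\<bar> + \<bar>up u (- a)\<bar>"
  have "up u (- (a + \<mu> *\<^sub>R u)) = up u (- a) - \<mu>"
    using up_shift[OF u_in_K, of "- a" "- \<mu>"] by simp
  then have "ou_norm C u (a + \<mu> *\<^sub>R u) = max (up u a + \<mu>) (up u (- a) - \<mu>)"
    unfolding ou_norm_eq up_shift[OF u_in_K] by simp
  also have "\<dots> = up u a + \<mu>" by (simp add: \<mu>_def)
  finally show ?thesis using ou_norm_eq_spin[OF assms, of \<mu>] by (simp add: \<mu>_def)
qed

lemma lo_H:
  assumes "a \<in> H" shows "lo u a = - sqrt (ip a a)"
proof -
  have "- a \<in> H" using assms H_subspace by (rule subspace_neg[rotated])
  moreover have "ip (- a) (- a) = ip a a"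
    using ip_scale[of a "- a" "- 1"] ip_scale[of a a "- 1"] ip_commute[of a "- a"] assms \<open>- a \<in> H\<close> by simp
  ultimately show ?thesis by (simp add: lo_def up_H)
qed

definition spin_inverse :: "'a \<Rightarrow> 'a" where
  "spin_inverse v = (1 / Q v) *\<^sub>R ((2 * trc v) *\<^sub>R u - v)"

lemma trc_coords: "a \<in> H \<Longrightarrow> trc (a + \<alpha> *\<^sub>R u) = \<alpha>"
  by (simp add: trc_def up_shift lo_shift u_in_K up_H lo_H)

lemma Q_coords:
  assumes "a \<in> H" shows "Q (a + \<alpha> *\<^sub>R u) = \<alpha>\<^sup>2 - ip a a"
proof -
  have "Q (a + \<alpha> *\<^sub>R u) = \<alpha>\<^sup>2 - sqrt (ip a a) * sqrt (ip a a)"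
    by (simp add: rdet_def up_shift lo_shift u_in_K up_H lo_H assms algebra_simps power2_eq_square)
  then show ?thesis using ip_nonneg[OF assms] by simp
qed

lemma spin_inverse_coords:
  assumes "a \<in> H"
  shows "spin_inverse (a + \<alpha> *\<^sub>R u) = (- (1 / Q (a + \<alpha> *\<^sub>R u))) *\<^sub>R a + (\<alpha> / Q (a + \<alpha> *\<^sub>R u)) *\<^sub>R u"
proof -
  have "(2 * trc (a + \<alpha> *\<^sub>R u)) *\<^sub>R u - (a + \<alpha> *\<^sub>R u) = \<alpha> *\<^sub>R u - a"
    unfolding trc_coords[OF assms] mult_2 scaleR_left_distrib by simp
  then show ?thesis unfolding spin_inverse_def by (simp only: scaleR_diff_right) simp
qed

lemma ip_lincomb:
  assumes "a \<in> H" "b \<in> H"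
  shows "ip (s *\<^sub>R a + t *\<^sub>R b) (s *\<^sub>R a + t *\<^sub>R b) = s\<^sup>2 * ip a a + 2 * s * t * ip a b + t\<^sup>2 * ip b b"
proof -
  have H: "s *\<^sub>R a \<in> H" "t *\<^sub>R b \<in> H" "s *\<^sub>R a + t *\<^sub>R b \<in> H"
    using assms H_subspace by (auto intro: subspace_add subspace_scale)
  have *: "ip v (s *\<^sub>R a + t *\<^sub>R b) = s * ip a v + t * ip b v" if "v \<in> H" for v
  proof -
    have "ip v (s *\<^sub>R a + t *\<^sub>R b) = ip (s *\<^sub>R a + t *\<^sub>R b) v" by (rule ip_commute[OF that H(3)])
    then show ?thesis by (simp add: ip_add ip_scale H assms that)
  qed
  have "ip (s *\<^sub>R a + t *\<^sub>R b) (s *\<^sub>R a + t *\<^sub>R b) = s * ip a (s *\<^sub>R a + t *\<^sub>R b) + t * ip b (s *\<^sub>R a + t *\<^sub>R b)"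
    by (rule *[OF H(3)])
  also have "\<dots> = s * (s * ip a a + t * ip b a) + t * (s * ip a b + t * ip b b)"
    unfolding *[OF assms(1)] *[OF assms(2)] ..
  also have "\<dots> = s\<^sup>2 * ip a a + 2 * s * t * ip a b + t\<^sup>2 * ip b b"
    unfolding ip_commute[OF assms(2,1)] by (simp add: algebra_simps power2_eq_square)
  finally show ?thesis .
qed

lemma Q_lincomb:
  assumes "a \<in> H" "b \<in> H"
  shows "Q (s *\<^sub>R (a + \<alpha> *\<^sub>R u) + t *\<^sub>R (b + \<beta> *\<^sub>R u)) =
    s\<^sup>2 * Q (a + \<alpha> *\<^sub>R u) + 2 * s * t * (\<alpha> * \<beta> - ip a b) + t\<^sup>2 * Q (b + \<beta> *\<^sub>R u)"
proof -
  have eq: "s *\<^sub>R (a + \<alpha> *\<^sub>R u) + t *\<^sub>R (b + \<beta> *\<^sub>R u) = (s *\<^sub>R a + t *\<^sub>R b) + (s * \<alpha> + t * \<beta>) *\<^sub>R u"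
    by (simp add: algebra_simps)
  have H: "s *\<^sub>R a + t *\<^sub>R b \<in> H"
    using assms H_subspace by (auto intro: subspace_add subspace_scale)
  show ?thesis unfolding eq Q_coords[OF H] Q_coords[OF assms(1)] Q_coords[OF assms(2)] ip_lincomb[OF assms]
    by (simp add: algebra_simps power2_eq_square)
qed

lemma lo_spin_inverse:
  assumes "v \<in> K" shows "lo u (spin_inverse v) = lo u v / Q v" "up u (spin_inverse v) = up u v / Q v"
proof -
  have eq: "spin_inverse v = (1 / Q v) *\<^sub>R (- v + (2 * trc v) *\<^sub>R u)" by (simp add: spin_inverse_def)
  have "0 < 1 / Q v" using rdet_pos[OF u_in_K assms] by simp
  then show "lo u (spin_inverse v) = lo u v / Q v" "up u (spin_inverse v) = up u v / Q v"
    unfolding eq lo_scale[OF u_in_K \<open>0 < 1 / Q v\<close>] up_scale[OF u_in_K \<open>0 < 1 / Q v\<close>]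
      lo_shift[OF u_in_K] up_shift[OF u_in_K] lo_minus up_minus by (simp_all add: trc_def field_simps)
qed

lemma spin_inverse_K: "v \<in> K \<Longrightarrow> spin_inverse v \<in> K"
  using rdet_pos[OF u_in_K, of v] lo_spin_inverse[of v] by (simp add: in_K_iff_lo[OF u_in_K])

lemma Q_spin_inverse: "v \<in> K \<Longrightarrow> Q (spin_inverse v) = 1 / Q v"
  using rdet_pos[OF u_in_K, of v] lo_spin_inverse[of v] by (simp add: rdet_def)

lemma spin_inverse_invol:
  assumes "v \<in> K" shows "spin_inverse (spin_inverse v) = v"
proof -
  have Q: "Q v \<noteq> 0" using rdet_pos[OF u_in_K assms] by simp
  have t: "trc (spin_inverse v) = trc v / Q v"
    by (simp add: trc_def lo_spin_inverse[OF assms] add_divide_distrib)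
  have "spin_inverse (spin_inverse v) = Q v *\<^sub>R ((2 * (trc v / Q v)) *\<^sub>R u - (1 / Q v) *\<^sub>R ((2 * trc v) *\<^sub>R u - v))"
    unfolding spin_inverse_def[of "spin_inverse v"] Q_spin_inverse[OF assms] t
    by (simp add: spin_inverse_def)
  also have "\<dots> = v" using Q by (simp add: scaleR_diff_right)
  finally show ?thesis .
qed

text \<open>
  If \<open>(x | y)\<close> denotes the polar form of \<open>Q\<close>, then the conjugates \<open>\<alpha> u - a\<close> and \<open>\<beta> u - b\<close> have the same
  values of \<open>Q\<close> and of the polar form as \<open>x\<close> and \<open>y\<close>, so the left side is
  \<open>1 / Q x - 2 (x | y) / (Q x Q y) + 1 / Q y\<close>.
\<close>

lemma Q_spin_inverse_diff:
  assumes K: "x \<in> K" "y \<in> K"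
  shows "Q (spin_inverse x - spin_inverse y) = Q (y - x) / (Q x * Q y)"
proof -
  obtain a \<alpha> where x: "a \<in> H" "x = a + \<alpha> *\<^sub>R u" by (rule spin_coords)
  obtain b \<beta> where y: "b \<in> H" "y = b + \<beta> *\<^sub>R u" by (rule spin_coords)
  have mH: "- a \<in> H" "- b \<in> H" using x y H_subspace by (auto intro: subspace_neg)
  have pos: "Q x \<noteq> 0" "Q y \<noteq> 0" using rdet_pos[OF u_in_K] K by fastforce+
  have ipm: "ip (- c) (- d) = ip c d" if "c \<in> H" "d \<in> H" for c d
    using ip_scale[of c "- d" "- 1"] ip_scale[of d c "- 1"] ip_commute[of c "- d"] ip_commute[of c d]
      that subspace_neg[OF H_subspace] by simp
  have conj: "Q (- c + \<gamma> *\<^sub>R u) = Q (c + \<gamma> *\<^sub>R u)" if "c \<in> H" for c \<gamma>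
    using that subspace_neg[OF H_subspace] by (simp only: Q_coords ipm)
  have inv: "spin_inverse x - spin_inverse y =
    (1 / Q x) *\<^sub>R (- a + \<alpha> *\<^sub>R u) + (- (1 / Q y)) *\<^sub>R (- b + \<beta> *\<^sub>R u)"
    unfolding x(2) y(2) spin_inverse_coords[OF x(1)] spin_inverse_coords[OF y(1)]
    by (simp add: scaleR_add_right scaleR_diff_right)
  have "Q (spin_inverse x - spin_inverse y) =
    (1 / Q x)\<^sup>2 * Q x + 2 * (1 / Q x) * (- (1 / Q y)) * (\<alpha> * \<beta> - ip a b) + (- (1 / Q y))\<^sup>2 * Q y"
    unfolding inv Q_lincomb[OF mH] ipm[OF x(1) y(1)] conj[OF x(1)] conj[OF y(1)] by (simp add: x(2) y(2))
  also have "\<dots> = (Q x - 2 * (\<alpha> * \<beta> - ip a b) + Q y) / (Q x * Q y)"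
    using pos by (simp add: field_simps power2_eq_square)
  also have "Q x - 2 * (\<alpha> * \<beta> - ip a b) + Q y = Q (y - x)"
    using Q_lincomb[OF x(1) y(1), of "- 1" \<alpha> 1 \<beta>] unfolding x(2)[symmetric] y(2)[symmetric] by simp
  finally show ?thesis .
qed

text \<open>
  Both eigenvalues are monotone. Equality of the determinants of comparable interior points forces
  equality of both eigenvalues, hence of the traces, and \<open>C\<close> contains no nonzero vector of trace \<open>0\<close>.
\<close>

lemma Q_mono:
  assumes x: "x \<in> K" and d: "y - x \<in> C"
  shows "Q x \<le> Q y" "Q x = Q y \<Longrightarrow> x = y"
proof -
  have lo: "0 < lo u x" "lo u x \<le> up u x" using x lo_le_up u_in_K by (auto simp: in_K_iff_lo[OF u_in_K])
  have l: "lo u x \<le> lo u y"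
    unfolding le_lo_iff[OF u_in_K] using C_add[OF lo_bound[OF u_in_K, of x] d] by simp
  have u: "up u x \<le> up u y"
    unfolding up_le_iff[OF u_in_K] using C_add[OF up_bound[OF u_in_K, of y] d] by simp
  show "Q x \<le> Q y" unfolding rdet_def using l u lo by (intro mult_mono) auto
  assume "Q x = Q y"
  then have "lo u x = lo u y \<and> up u x = up u y"
    using l u lo unfolding rdet_def
    by (smt (verit, best) mult_strict_mono mult_le_cancel_left_pos mult_le_cancel_right_pos)
  then have t: "trc x = trc y" by (simp add: trc_def)
  obtain a \<alpha> where x: "a \<in> H" "x = a + \<alpha> *\<^sub>R u" by (rule spin_coords)
  obtain b \<beta> where y: "b \<in> H" "y = b + \<beta> *\<^sub>R u" by (rule spin_coords)
  have "y - x \<in> H"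
    using t x y subspace_diff[OF H_subspace y(1) x(1)] by (simp add: trc_coords)
  then have "lo u (y - x) = - sqrt (ip (y - x) (y - x))" by (rule lo_H)
  then have "ip (y - x) (y - x) = 0"
    using d ip_nonneg[OF \<open>y - x \<in> H\<close>] by (simp add: in_C_iff_lo_u)
  then show "x = y" using ip_zero_iff[OF \<open>y - x \<in> H\<close>] by simp
qed

lemma C_or_minus_C: "0 \<le> Q v \<Longrightarrow> v \<in> C \<or> - v \<in> C"
  using lo_le_up[OF u_in_K, of v] unfolding in_C_iff_lo_u lo_minus rdet_def
  by (auto simp: zero_le_mult_iff)

lemma C_imp_Q: "v \<in> C \<Longrightarrow> 0 \<le> Q v"
  using lo_le_up[OF u_in_K, of v] unfolding in_C_iff_lo_u rdet_def by simp

text \<open>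
  The identity for \<open>Q\<close> puts the difference of the inverses in \<open>C\<close> or \<open>- C\<close>. In the second case
  monotonicity of \<open>Q\<close> applied to both pairs gives \<open>Q x = Q y\<close>, so \<open>x = y\<close>.
\<close>

lemma spin_inverse_antitone:
  assumes K: "x \<in> K" "y \<in> K" and d: "y - x \<in> C"
  shows "spin_inverse x - spin_inverse y \<in> C"
proof -
  have "0 \<le> Q (spin_inverse x - spin_inverse y)"
    unfolding Q_spin_inverse_diff[OF K] using C_imp_Q[OF d] rdet_pos[OF u_in_K] K by (simp add: less_imp_le)
  then consider "spin_inverse x - spin_inverse y \<in> C" | "spin_inverse y - spin_inverse x \<in> C"
    using C_or_minus_C by fastforce
  then show ?thesis
  proof cases
    case 2
    then have "1 / Q x \<le> 1 / Q y"
      using Q_mono(1)[OF spin_inverse_K[OF K(1)] 2] K by (simp add: Q_spin_inverse)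
    then have "Q y \<le> Q x" using rdet_pos[OF u_in_K] K by (simp add: field_simps)
    then have "x = y" using Q_mono[OF K(1) d] by simp
    then show ?thesis using C_zero by simp
  qed
qed

lemma spin_inverse_antimorphism:
  "bij_betw spin_inverse K K" "antihomogeneous_on K spin_inverse"
  "order_antimorphism_on C K spin_inverse"
proof -
  show "bij_betw spin_inverse K K"
    by (rule bij_betw_byWitness[where f' = spin_inverse]) (auto simp: spin_inverse_invol spin_inverse_K)
  have "spin_inverse (\<mu> *\<^sub>R x) = (1 / \<mu>) *\<^sub>R spin_inverse x" if "0 < \<mu>" for \<mu> x
  proof -
    have "Q (\<mu> *\<^sub>R x) = \<mu>\<^sup>2 * Q x" "trc (\<mu> *\<^sub>R x) = \<mu> * trc x"
      using that by (simp_all add: Q_scale_pos trc_scale_pos)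
    moreover have "(2 * (\<mu> * trc x)) *\<^sub>R u - \<mu> *\<^sub>R x = \<mu> *\<^sub>R ((2 * trc x) *\<^sub>R u - x)"
      by (simp add: scaleR_diff_right mult_ac)
    ultimately show ?thesis using that by (simp add: spin_inverse_def power2_eq_square)
  qed
  then show "antihomogeneous_on K spin_inverse" by (simp add: antihomogeneous_on_def)
  have "y - x \<in> C \<longleftrightarrow> spin_inverse x - spin_inverse y \<in> C" if "x \<in> K" "y \<in> K" for x y
    using spin_inverse_antitone[of x y] spin_inverse_antitone[of "spin_inverse y" "spin_inverse x"]
      that by (auto simp: spin_inverse_invol spin_inverse_K)
  then show "order_antimorphism_on C K spin_inverse"
    by (auto simp: order_antimorphism_on_def cone_le_def spin_inverse_K)
qed

end

section \<open>The characterization\<close>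

lemma order_unit_nonzero:
  fixes C :: "'a::real_vector set"
  assumes ou: "order_unit_space C u" and big: "dim_at_least TYPE('a) 3"
  shows "u \<noteq> 0"
proof
  assume "u = 0"
  have C: "- x \<in> C" for x :: 'a
    using ou \<open>u = 0\<close> unfolding order_unit_space_def order_unit_def cone_le_def by force
  have "C \<inter> uminus ` C = {0}"
    using ou by (auto simp: order_unit_space_def archimedean_cone_def pointed_cone_def)
  then have zero: "x = 0" for x :: 'a using C[of x] C[of "- x"] by (metis IntI imageI minus_minus singletonD)
  obtain B :: "'a set" where "independent B" "infinite B \<or> 3 \<le> card B"
    using big by (auto simp: dim_at_least_def)
  moreover have "B = {}" using zero dependent_zero[of B] \<open>independent B\<close> by (metis equals0I)
  ultimately show False by simp
qed

theorem theorem1p1: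
  fixes C :: "'a::real_vector set" and u :: 'a
  assumes "order_unit_space C u"
    and "ou_complete C u"
    and "strictly_convex_cone C u"
    and "dim_at_least TYPE('a) 3"
  shows "(\<exists>g. bij_betw g (cone_interior C u) (cone_interior C u) \<and>
              antihomogeneous_on (cone_interior C u) g \<and>
              order_antimorphism_on C (cone_interior C u) g)
         \<longleftrightarrow> spin_factor C u"
proof -
  interpret strict_ou_space C u
    using assms order_unit_nonzero by unfold_locales auto
  show ?thesis
    unfolding cone_interior_eq
  proof
    assume "\<exists>g. bij_betw g K K \<and> antihomogeneous_on K g \<and> order_antimorphism_on C K g"
    then obtain g where g: "bij_betw g K K" "antihomogeneous_on K g" "order_antimorphism_on C K g"
      by blast
    interpret bij_antimorphism C u g
      using g by unfold_locales
        (auto simp: antihomogeneous_on_def order_antimorphism_on_def cone_le_def)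
    interpret cocycle_ou_space C u
      by unfold_locales (rule rdet_cocycle)
    show "spin_factor C u" using assms(2) by (rule spin_factor_if_complete)
  next
    assume "spin_factor C u"
    then obtain H ip where "hilbert_subspace H ip" "direct_sum_decomposition H (span {u})"
      "\<forall>a\<in>H. \<forall>\<mu>. ou_norm C u (a + \<mu> *\<^sub>R u) = sqrt (ip a a) + \<bar>\<mu>\<bar>"
      unfolding spin_factor_def by blast
    then interpret spin_ou_space C u H ip
      by unfold_locales (simp_all add: hilbert_subspace_def)
    show "\<exists>g. bij_betw g K K \<and> antihomogeneous_on K g \<and> order_antimorphism_on C K g"
      using spin_inverse_antimorphism by blast
  qed
qed

end
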